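(* Let $\alpha$ be a countable ordinal and let $A\subseteq X_\alpha$. Then $A$ is a Banach-Saks set if and only if $\mathrm{conv}(A)$ is a Banach-Saks set.
   Context: A subset $A$ of a Banach space is a Banach-Saks set if every sequence in $A$ has a subsequence whose Ces\`aro means converge in norm. For a family $\mathcal F$ of finite subsets of $\mathbb N$, $X_{\mathcal F}$ is the completion of $c_{00}(\mathbb N)$ under $\|x\|_{\mathcal F}=\max\{\|x\|_\infty,\sup_{s\in\mathcal F}\sum_{n\in s}|(x)_n|\}$. The Schreier family is $\mathcal S=\{s\subseteq\mathbb N: \#s\le\min s\}$. For families $\mathcal F,\mathcal G$, $\mathcal F\otimes\mathcal G=\{s_0\cup\dots\cup s_n: s_0<\dots<s_n \text{ in }\mathcal F,\ \{\min s_i\}_{i\le n}\in\mathcal G\}$, where $s<t$ means $\max s<\min t$. For each countable limit ordinal $\alpha$ fix a strictly increasing sequence $(\beta_n^{(\alpha)})_n$ with supremum $\alpha$. The generalized Schreier families are defined by $\mathcal S_0=\{s\subseteq\mathbb N:\#s\le1\}$, $\mathcal S_{\alpha+1}=\mathcal S_\alpha\otimes\mathcal S$, and for limit $\alpha$, $\mathcal S_\alpha=\bigcup_n\{s\in\mathcal S_{\beta_n^{(\alpha)}}: s\subseteq[n+1,\infty)\}$. Then $X_\alpha:=X_{\mathcal S_\alpha}$. *)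

theory Defs
  imports "HOL-Analysis.Analysis"
begin

text \<open>Convention: the coordinate set \<open>\<nat>\<close> of the paper is {1,2,...}; sequences are
  functions nat => real that vanish at 0.  Countable ordinals are represented by
  well-orders on subsets of nat (compared via ordLess / ordLeq / ordIso).\<close>

definition schreier :: "nat set set" where
  "schreier = {s. finite s \<and> s \<subseteq> {1..} \<and> (s = {} \<or> card s \<le> Min s)}"

definition fam_otimes :: "nat set set \<Rightarrow> nat set set \<Rightarrow> nat set set" where
  "fam_otimes F G = {s. \<exists>ss :: nat set list. ss \<noteq> [] \<and> (\<forall>t\<in>set ss. t \<in> F \<and> t \<noteq> {}) \<and>
      sorted_wrt (\<lambda>a b. Max a < Min b) ss \<and> Min ` set ss \<in> G \<and> s = \<Union>(set ss)}"

lemma fam_otimes_mono [mono]: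
  "(\<And>t. P t \<longrightarrow> Q t) \<Longrightarrow> s \<in> fam_otimes {t. P t} G \<longrightarrow> s \<in> fam_otimes {t. Q t} G"
  unfolding fam_otimes_def by blast

definition ord_is_max :: "nat rel \<Rightarrow> nat \<Rightarrow> bool" where
  "ord_is_max r m \<longleftrightarrow> m \<in> Field r \<and> (\<forall>x\<in>Field r. (x, m) \<in> r)"

definition ord_is_limit :: "nat rel \<Rightarrow> bool" where
  "ord_is_limit r \<longleftrightarrow> Field r \<noteq> {} \<and> \<not> (\<exists>m. ord_is_max r m)"

text \<open>Generalized Schreier families S_alpha, alpha the order type of the well-order r,
  with fundamental sequences given by beta: for limit r, (beta r n)_{n>=1}.\<close>
inductive in_schreier_gen :: "(nat rel \<Rightarrow> nat \<Rightarrow> nat rel) \<Rightarrow> nat rel \<Rightarrow> nat set \<Rightarrow> bool"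
  for \<beta> :: "nat rel \<Rightarrow> nat \<Rightarrow> nat rel" where
  zero: "Field r = {} \<Longrightarrow> finite s \<Longrightarrow> s \<subseteq> {1..} \<Longrightarrow> card s \<le> 1 \<Longrightarrow> in_schreier_gen \<beta> r s"
| succ: "ord_is_max r m \<Longrightarrow>
         s \<in> fam_otimes {t. in_schreier_gen \<beta> (Restr r (Field r - {m})) t} schreier \<Longrightarrow>
         in_schreier_gen \<beta> r s"
| lim: "ord_is_limit r \<Longrightarrow> 1 \<le> n \<Longrightarrow> in_schreier_gen \<beta> (\<beta> r n) s \<Longrightarrow> s \<subseteq> {n+1..} \<Longrightarrow>
         in_schreier_gen \<beta> r s"

definition schreier_gen :: "(nat rel \<Rightarrow> nat \<Rightarrow> nat rel) \<Rightarrow> nat rel \<Rightarrow> nat set set" where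
  "schreier_gen \<beta> r = {s. in_schreier_gen \<beta> r s}"

definition normF :: "nat set set \<Rightarrow> (nat \<Rightarrow> real) \<Rightarrow> real" where
  "normF F x = max (SUP n. \<bar>x n\<bar>) (SUP s\<in>F. \<Sum>n\<in>s. \<bar>x n\<bar>)"

text \<open>X_F: the completion of c00 under the F-norm, realised concretely as the closure
  of c00 in the space of sequences of finite F-norm, i.e. those whose tails have
  F-norm tending to 0.\<close>
definition XF :: "nat set set \<Rightarrow> (nat \<Rightarrow> real) set" where
  "XF F = {x. x 0 = 0 \<and> bdd_above (range (\<lambda>n. \<bar>x n\<bar>)) \<and>
              bdd_above ((\<lambda>s. \<Sum>n\<in>s. \<bar>x n\<bar>) ` F) \<and>
              (\<lambda>k. normF F (\<lambda>n. if n < k then 0 else x n)) \<longlonglongrightarrow> 0}"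

definition banach_saks_set :: "nat set set \<Rightarrow> (nat \<Rightarrow> real) set \<Rightarrow> bool" where
  "banach_saks_set F A \<longleftrightarrow>
     (\<forall>x :: nat \<Rightarrow> nat \<Rightarrow> real. (\<forall>n. x n \<in> A) \<longrightarrow>
        (\<exists>g y. strict_mono g \<and> y \<in> XF F \<and>
           (\<lambda>n. normF F (\<lambda>m. (\<Sum>i<Suc n. x (g i) m) / real (Suc n) - y m)) \<longlonglongrightarrow> 0))"

definition conv_set :: "(nat \<Rightarrow> real) set \<Rightarrow> (nat \<Rightarrow> real) set" where
  "conv_set A = {y. \<exists>k (c :: nat \<Rightarrow> real) v. (\<forall>i<k. 0 \<le> c i \<and> v i \<in> A) \<and>
                    (\<Sum>i<k. c i) = 1 \<and> y = (\<lambda>m. \<Sum>i<k. c i * v i m)}"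

end

theory Submission
  imports Defs "HOL-Complex_Analysis.Great_Picard"
begin

text \<open>
  Attach to \<open>S\<^sub>\<alpha>\<close> lower families \<open>L p\<close>: the predecessor family if \<open>\<alpha>\<close> is a successor, the families
  of the fundamental sequence if \<open>\<alpha>\<close> is a limit. An admissible union of sets of \<open>L p\<close> far to the right
  lies in \<open>S\<^sub>\<alpha>\<close>, so a sequence in \<open>A\<close> that keeps mass on sets of \<open>L p\<close> moving to infinity generates an
  \<open>\<ell>\<^sub>1\<close> spreading model, and if \<open>A\<close> is Banach-Saks the tails of its elements are uniformly small on
  each \<open>L p\<close>. This condition passes to the convex hull. Conversely, a set of \<open>S\<^sub>\<alpha>\<close> that starts at
  \<open>q\<close> is covered, beyond \<open>q\<close>, by boundedly many sets of lower families, so under this condition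
  a bounded pointwise null sequence in \<open>X\<^sub>\<alpha>\<close> has a subsequence with bounded partial sums, as in
  \<open>c\<^sub>0\<close>. What remains is that pointwise limits of sequences in the convex hull stay in \<open>X\<^sub>\<alpha>\<close>,
  an instance of Krein's theorem.
\<close>

section \<open>Generalized Schreier families\<close>

unbundle cardinal_syntax
no_notation (input) elt_set_eq (infix "=o" 50)

text \<open>Being Banach-Saks speaks of subsequences, and a sequence of convex combinations whose
  ingredients change with the index offers no sequence in \<open>A\<close> to apply it to. Hence the
  detour through a uniform estimate on coordinates, which averages inherit. Small tails in the norm
  itself would be too much to ask: for \<alpha> = 0 the norm is the supremum norm, and the unit
  vectors are Banach-Saks with tails of norm 1. So tails are tested only on families small enough
  for admissible unions of their sets to stay in \<open>S\<^sub>\<alpha>\<close>.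

  A single lower family does not do at limits, where there is no predecessor and sets starting
  further right may come from later terms of the fundamental sequence. Inclusions between the
  families hold only far to the right: \<open>{1}\<close> is in \<open>S\<^sub>0\<close> but in no
  family of a limit ordinal.

  The locale \<open>schreier_like\<close> isolates what is needed of
  \<open>S\<^sub>\<alpha>\<close>, so the analysis involves no ordinals. It involves no weak
  topology either: bounded sequences have pointwise convergent subsequences with bounded limit, and
  only the vanishing of the tails of that limit is at stake.\<close>

lemma underS_ord_is_max:
  assumes "Well_order r" "ord_is_max r m"
  shows "underS r m = Field r - {m}"
proof -
  have "x \<in> Field r - {m} \<Longrightarrow> x \<in> underS r m" for x
    using assms by (auto simp: ord_is_max_def underS_def)
  then show ?thesis
    by (auto simp: underS_def intro: FieldI1)
qed

lemma Restr_ord_is_max_ordLess: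
  assumes "Well_order r" "ord_is_max r m"
  shows "Restr r (Field r - {m}) <o r"
  using assms underS_Restr_ordLess[OF assms(1), of m] underS_ord_is_max[OF assms]
  by (auto simp: ord_is_max_def)

text \<open>An order below \<open>r\<close> is isomorphic to some segment \<open>underS r a\<close>,
  and each such segment lies in the one cut off by the maximum. So removing the maximum yields the
  predecessor ordinal.\<close>

lemma ordLess_imp_ordLeq_Restr_ord_is_max:
  assumes r: "Well_order r" and m: "ord_is_max r m" and q: "q <o r"
  shows "q \<le>o Restr r (Field r - {m})"
proof -
  have wr: "wo_rel r" using r by (simp add: wo_rel_def)
  have "Well_order q" using q by (simp add: ordLess_def)
  then obtain a where a: "a \<in> Field r" "q =o Restr r (underS r a)"
    using ordLess_iff_ordIso_Restr[OF r] q by blast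
  have "underS r a \<subseteq> underS r m"
    using a(1) m r by (intro underS_incr) (auto simp: ord_is_max_def order_on_defs)
  then have "Restr r (underS r a) \<le>o Restr r (underS r m)"
    using ofilter_subset_ordLeq[OF r wo_rel.underS_ofilter[OF wr] wo_rel.underS_ofilter[OF wr]] by blast
  then show ?thesis
    using a(2) ordIso_ordLeq_trans underS_ord_is_max[OF r m] by metis
qed

lemma ordIso_Restr_ord_is_max:
  assumes "r =o r'" and m: "ord_is_max r m"
  obtains m' where "ord_is_max r' m'" "Restr r (Field r - {m}) =o Restr r' (Field r' - {m'})"
proof -
  obtain f where r: "Well_order r" "Well_order r'" and f: "iso r r' f"
    using assms(1) by (auto simp: ordIso_def)
  have bij: "bij_betw f (Field r) (Field r')"
    and ord: "\<And>a b. a \<in> Field r \<Longrightarrow> b \<in> Field r \<Longrightarrow> (a, b) \<in> r \<longleftrightarrow> (f a, f b) \<in> r'"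
    using f by (auto simp: iso_iff2)
  have F: "Field (Restr q (Field q - {k})) = Field q - {k}" if "Well_order q" for q :: "nat rel" and k
    using that by (intro Refl_Field_Restr2) (auto simp: order_on_defs)
  have mF: "m \<in> Field r" using m by (simp add: ord_is_max_def)
  have max: "ord_is_max r' (f m)"
    unfolding ord_is_max_def
  proof (intro conjI ballI)
    show "f m \<in> Field r'" using bij mF by (auto simp: bij_betw_def)
    fix y assume "y \<in> Field r'"
    then obtain x where "x \<in> Field r" "y = f x" using bij by (auto simp: bij_betw_def)
    then show "(y, f m) \<in> r'" using ord mF m by (auto simp: ord_is_max_def)
  qed
  have "bij_betw f (Field r - {m}) (Field r' - {f m})"
    using bij mF by (auto simp: bij_betw_def inj_on_def)
  then have "iso (Restr r (Field r - {m})) (Restr r' (Field r' - {f m})) f"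
    unfolding iso_iff2 F[OF r(1)] F[OF r(2)] using ord by (auto simp: bij_betw_def)
  then have "Restr r (Field r - {m}) =o Restr r' (Field r' - {f m})"
    using r Well_order_Restr by (auto simp: ordIso_def)
  with max show ?thesis by (rule that)
qed

lemma ordIso_ord_is_limit:
  assumes "r =o r'" "ord_is_limit r"
  shows "ord_is_limit r'"
proof -
  have "Field r' \<noteq> {}"
    using assms by (fastforce simp: ord_is_limit_def ordIso_def iso_def bij_betw_def)
  moreover have "\<not> ord_is_max r' m" for m
    using ordIso_Restr_ord_is_max[OF ordIso_symmetric[OF assms(1)]] assms(2)
    by (metis ord_is_limit_def)
  ultimately show ?thesis by (auto simp: ord_is_limit_def)
qed

lemma ord_cases:
  obtains "Field r = {}" | m where "ord_is_max r m" | "ord_is_limit r"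
  by (auto simp: ord_is_limit_def)

lemma ord_is_max_unique:
  assumes "Well_order r" "ord_is_max r m" "ord_is_max r m'"
  shows "m = m'"
  using assms by (auto simp: ord_is_max_def order_on_defs antisym_def)

section \<open>The operation \<open>fam_otimes\<close> and the recursion for the families\<close>

lemma fam_otimes_mono': "F \<subseteq> F' \<Longrightarrow> fam_otimes F G \<subseteq> fam_otimes F' G"
  unfolding fam_otimes_def by blast

lemma schreier_gen_empty:
  assumes "Field r = {}"
  shows "schreier_gen \<beta> r = {s. finite s \<and> s \<subseteq> {1..} \<and> card s \<le> 1}"
proof -
  have "in_schreier_gen \<beta> r s \<longleftrightarrow> finite s \<and> s \<subseteq> {1..} \<and> card s \<le> 1" for s
    using assms unfolding in_schreier_gen.simps[of _ r s]
    by (auto simp: ord_is_max_def ord_is_limit_def)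
  then show ?thesis by (simp add: schreier_gen_def)
qed

lemma schreier_gen_max:
  assumes "Well_order r" "ord_is_max r m"
  shows "schreier_gen \<beta> r = fam_otimes (schreier_gen \<beta> (Restr r (Field r - {m}))) schreier"
proof (intro subset_antisym subsetI)
  fix s assume "s \<in> schreier_gen \<beta> r"
  then have "in_schreier_gen \<beta> r s" by (simp add: schreier_gen_def)
  then show "s \<in> fam_otimes (schreier_gen \<beta> (Restr r (Field r - {m}))) schreier"
  proof cases
    case zero then show ?thesis using assms by (simp add: ord_is_max_def)
  next
    case (succ m') then show ?thesis
      using ord_is_max_unique[OF assms] by (auto simp: schreier_gen_def)
  next
    case (lim n) then show ?thesis using assms by (auto simp: ord_is_limit_def)
  qed
qed (auto simp: schreier_gen_def intro: in_schreier_gen.succ[OF assms(2)])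

lemma schreier_gen_limit:
  assumes "ord_is_limit r"
  shows "schreier_gen \<beta> r = (\<Union>n\<in>{1..}. {s \<in> schreier_gen \<beta> (\<beta> r n). s \<subseteq> {n+1..}})"
proof -
  have "in_schreier_gen \<beta> r s \<longleftrightarrow> (\<exists>n\<ge>1. in_schreier_gen \<beta> (\<beta> r n) s \<and> s \<subseteq> {n+1..})" for s
    using assms unfolding in_schreier_gen.simps[of _ r s] by (auto simp: ord_is_limit_def)
  then show ?thesis by (auto simp: schreier_gen_def)
qed

text \<open>Successive blocks have distinct minima, so the Schreier condition on the set of minima
  becomes a bound on the number of blocks by the least element of the union.\<close>

lemma sorted_blocks_Min:
  fixes ss :: "nat set list"
  assumes "ss \<noteq> []" "\<And>t. t \<in> set ss \<Longrightarrow> finite t \<and> t \<noteq> {}" "sorted_wrt (\<lambda>a b. Max a < Min b) ss"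
  shows "distinct (map Min ss)" "card (Min ` set ss) = length ss"
    "Min (\<Union>(set ss)) = Min (Min ` set ss)"
proof -
  have lt: "Min a < Min b" if "a \<in> set ss" "b \<in> set ss" "Max a < Min b" for a b
    using that assms(2) by (meson Max_ge Min_in le_less_trans)
  have "sorted_wrt (<) (map Min ss)"
    unfolding sorted_wrt_map by (rule sorted_wrt_mono_rel[OF _ assms(3)]) (use lt in blast)
  then show d: "distinct (map Min ss)" by (simp add: strict_sorted_iff)
  show "card (Min ` set ss) = length ss"
    using distinct_card[OF d] by simp
  show "Min (\<Union>(set ss)) = Min (Min ` set ss)"
  proof (rule Min_eqI)
    have "Min (Min ` set ss) \<in> Min ` set ss" using assms(1) by (intro Min_in) auto
    then obtain t where "t \<in> set ss" "Min (Min ` set ss) = Min t" by auto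
    then show "Min (Min ` set ss) \<in> \<Union>(set ss)" using assms(2) Min_in[of t] by (intro UnionI[of t]) auto
    fix y assume "y \<in> \<Union>(set ss)"
    then obtain t where "t \<in> set ss" "y \<in> t" by auto
    then show "Min (Min ` set ss) \<le> y"
      using assms(2) by (meson List.finite_set Min_le finite_imageI imageI le_trans)
  qed (use assms(2) in auto)
qed

text \<open>Cutting the blocks down to \<open>t\<close> and dropping the empty ones neither
  increases their number nor lowers the minimum, so admissibility survives. The empty
  \<open>t\<close> is excluded because \<open>fam_otimes\<close> unites at least one block and only
  nonempty ones.\<close>

lemma fam_otimes_subset:
  assumes her: "\<And>s t. s \<in> F \<Longrightarrow> t \<subseteq> s \<Longrightarrow> t \<noteq> {} \<Longrightarrow> t \<in> F"
    and fin: "\<And>s. s \<in> F \<Longrightarrow> finite s \<and> s \<subseteq> {1..}"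
    and s: "s \<in> fam_otimes F schreier" and t: "t \<subseteq> s" "t \<noteq> {}"
  shows "t \<in> fam_otimes F schreier"
proof -
  obtain ss where ss: "ss \<noteq> []" "\<forall>t\<in>set ss. t \<in> F \<and> t \<noteq> {}"
      "sorted_wrt (\<lambda>a b. Max a < Min b) ss" "Min ` set ss \<in> schreier" "s = \<Union>(set ss)"
    using s by (auto simp: fam_otimes_def)
  define tt where "tt = filter (\<lambda>a. a \<noteq> {}) (map (\<lambda>a. a \<inter> t) ss)"
  have stt: "set tt = {a \<inter> t | a. a \<in> set ss \<and> a \<inter> t \<noteq> {}}" by (auto simp: tt_def)
  have "set tt = (\<lambda>a. a \<inter> t) ` set ss - {{}}" by (auto simp: tt_def)
  then have U: "t = \<Union>(set tt)" using t ss(5) by blast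
  have ne: "tt \<noteq> []"
  proof
    assume "tt = []"
    then have "\<Union>(set tt) = {}" by simp
    with U t(2) show False by argo
  qed
  have inF: "\<forall>a\<in>set tt. a \<in> F \<and> a \<noteq> {}"
  proof
    fix a assume "a \<in> set tt"
    then obtain b where b: "a = b \<inter> t" "b \<in> set ss" "a \<noteq> {}" by (auto simp: stt)
    then show "a \<in> F \<and> a \<noteq> {}" using her[of b a] ss(2) by simp
  qed
  have fint: "\<And>a. a \<in> set tt \<Longrightarrow> finite a \<and> a \<noteq> {}" using inF fin by blast
  have fins: "\<And>a. a \<in> set ss \<Longrightarrow> finite a \<and> a \<noteq> {}" using ss fin by blast
  have sorted: "sorted_wrt (\<lambda>a b. Max a < Min b) tt"
  proof -
    have "sorted_wrt (\<lambda>a b. a \<inter> t \<noteq> {} \<longrightarrow> b \<inter> t \<noteq> {} \<longrightarrow> Max (a \<inter> t) < Min (b \<inter> t)) ss"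
    proof (rule sorted_wrt_mono_rel[OF _ ss(3)])
      fix a b assume "a \<in> set ss" "b \<in> set ss" and ab: "Max a < Min b"
      then have "finite a" "finite b" using fins by auto
      then have "a \<inter> t \<noteq> {} \<Longrightarrow> Max (a \<inter> t) \<le> Max a" "b \<inter> t \<noteq> {} \<Longrightarrow> Min b \<le> Min (b \<inter> t)"
        by (auto intro!: Max_mono Min_antimono)
      then show "a \<inter> t \<noteq> {} \<longrightarrow> b \<inter> t \<noteq> {} \<longrightarrow> Max (a \<inter> t) < Min (b \<inter> t)" using ab by linarith
    qed
    then show ?thesis unfolding tt_def
      by (induction ss) auto
  qed
  have "Min ` set tt \<in> schreier"
  proof -
    have "card (Min ` set tt) = length tt" using sorted_blocks_Min[OF ne fint sorted] by simp
    also have "\<dots> \<le> length ss"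
      unfolding tt_def by (metis length_filter_le length_map)
    also have "\<dots> = card (Min ` set ss)" using sorted_blocks_Min[OF ss(1) fins ss(3)] by simp
    also have "\<dots> \<le> Min (Min ` set ss)" using ss(1,4) by (auto simp: schreier_def)
    also have "\<dots> = Min s" using sorted_blocks_Min[OF ss(1) fins ss(3)] ss(5) by simp
    also have "\<dots> \<le> Min t" using t fins ss(5) by (intro Min_antimono) auto
    also have "\<dots> = Min (Min ` set tt)" using sorted_blocks_Min[OF ne fint sorted] U by simp
    finally have "card (Min ` set tt) \<le> Min (Min ` set tt)" .
    moreover have "Min ` set tt \<subseteq> {1..}"
    proof
      fix x assume "x \<in> Min ` set tt"
      then obtain a where "a \<in> set tt" "x = Min a" by auto
      then show "x \<in> {1..}" using Min_in[of a] fint[of a] inF fin[of a] by auto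
    qed
    ultimately show ?thesis by (simp add: schreier_def)
  qed
  then show ?thesis unfolding fam_otimes_def using ne inF sorted U by blast
qed

lemma fam_otimes_schreier_superset:
  assumes "\<And>s. s \<in> F \<Longrightarrow> finite s \<and> s \<subseteq> {1..}" "s \<in> F" "s \<noteq> {}"
  shows "s \<in> fam_otimes F schreier"
proof -
  have "{Min s} \<in> schreier" using assms Min_in[of s] by (fastforce simp: schreier_def)
  then show ?thesis unfolding fam_otimes_def using assms
    by (intro CollectI exI[of _ "[s]"]) auto
qed

lemma fam_otimes_finite:
  assumes "\<And>s. s \<in> F \<Longrightarrow> finite s \<and> s \<subseteq> {1..}" "s \<in> fam_otimes F G"
  shows "finite s \<and> s \<subseteq> {1..} \<and> s \<noteq> {}"
  using assms by (fastforce simp: fam_otimes_def)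

text \<open>The families are indexed by concrete relations, not by order types;
  \<open>fund_inv\<close> makes \<beta> descend to order types, so that isomorphic well-orders get
  the same family.\<close>

locale fundamental_sequences =
  fixes \<beta> :: "nat rel \<Rightarrow> nat \<Rightarrow> nat rel"
  assumes fund_wo: "\<And>q n. Well_order q \<Longrightarrow> ord_is_limit q \<Longrightarrow> \<beta> q n <o q"
    and fund_incr: "\<And>q n. Well_order q \<Longrightarrow> ord_is_limit q \<Longrightarrow> 1 \<le> n \<Longrightarrow> \<beta> q n <o \<beta> q (Suc n)"
    and fund_sup: "\<And>q (p :: nat rel). Well_order q \<Longrightarrow> ord_is_limit q \<Longrightarrow> p <o q \<Longrightarrow>
                      \<exists>n\<ge>1. p \<le>o \<beta> q n"
    and fund_inv: "\<And>q q' n. ord_is_limit q \<Longrightarrow> q =o q' \<Longrightarrow> \<beta> q n =o \<beta> q' n"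
begin

lemma schreier_gen_ordIso_subset:
  assumes "r =o r'"
  shows "schreier_gen \<beta> r \<subseteq> schreier_gen \<beta> r'"
proof -
  have "in_schreier_gen \<beta> r' s" if "in_schreier_gen \<beta> r s" "r =o r'" for r r' s
    using that
  proof (induction arbitrary: r' rule: in_schreier_gen.induct)
    case (zero r s)
    then have "Field r' = {}" by (auto simp: ordIso_def iso_def bij_betw_def)
    with zero show ?case by (intro in_schreier_gen.zero)
  next
    case (succ r m s)
    obtain m' where m': "ord_is_max r' m'" "Restr r (Field r - {m}) =o Restr r' (Field r' - {m'})"
      using ordIso_Restr_ord_is_max[OF succ.prems succ.hyps(1)] .
    have "s \<in> fam_otimes {t. in_schreier_gen \<beta> (Restr r' (Field r' - {m'})) t} schreier"
      by (rule subsetD[OF fam_otimes_mono' succ.IH]) (use m'(2) in auto)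
    with m'(1) show ?case by (rule in_schreier_gen.succ)
  next
    case (lim r n s)
    have "in_schreier_gen \<beta> (\<beta> r' n) s"
      using lim.IH fund_inv lim.hyps lim.prems by blast
    then show ?case
      using in_schreier_gen.lim[OF ordIso_ord_is_limit[OF lim.prems lim.hyps(1)]] lim.hyps by blast
  qed
  then show ?thesis using assms by (auto simp: schreier_gen_def)
qed

lemma schreier_gen_ordIso: "r =o r' \<Longrightarrow> schreier_gen \<beta> r = schreier_gen \<beta> r'"
  using schreier_gen_ordIso_subset ordIso_symmetric by blast

lemma Well_order_induct [consumes 1, case_names less]:
  fixes r :: "nat rel"
  assumes "Well_order r"
    and "\<And>r. Well_order r \<Longrightarrow> (\<And>q. q <o r \<Longrightarrow> P q) \<Longrightarrow> P r"
  shows "P r"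
proof -
  have "Well_order r \<longrightarrow> P r"
    by (rule wf_induct[OF wf_ordLess]) (use assms(2) in \<open>auto simp: ordLess_def\<close>)
  with assms(1) show ?thesis by simp
qed

lemma schreier_gen_finite:
  assumes "Well_order r" "s \<in> schreier_gen \<beta> r"
  shows "finite s \<and> s \<subseteq> {1..}"
  using assms
proof (induction r arbitrary: s rule: Well_order_induct)
  case (less r)
  show ?case
  proof (cases rule: ord_cases[of r])
    case 1 then show ?thesis using less.prems by (simp add: schreier_gen_empty)
  next
    case (2 m)
    show ?thesis
      using fam_otimes_finite[OF less.IH[OF Restr_ord_is_max_ordLess[OF less.hyps 2]]] less.prems
      unfolding schreier_gen_max[OF less.hyps 2] by blast
  next
    case 3
    then show ?thesis
      using less.prems less.IH fund_wo[OF less.hyps 3] by (auto simp: schreier_gen_limit)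
  qed
qed

lemma schreier_gen_subset:
  assumes "Well_order r" "s \<in> schreier_gen \<beta> r" "t \<subseteq> s" "t \<noteq> {}"
  shows "t \<in> schreier_gen \<beta> r"
  using assms
proof (induction r arbitrary: s t rule: Well_order_induct)
  case (less r)
  show ?case
  proof (cases rule: ord_cases[of r])
    case 1
    have "card t \<le> card s" if "finite s" using less.prems that by (simp add: card_mono)
    then show ?thesis
      using less.prems 1 finite_subset by (fastforce simp: schreier_gen_empty)
  next
    case (2 m)
    have *: "Restr r (Field r - {m}) <o r" using Restr_ord_is_max_ordLess[OF less.hyps 2] .
    then have w: "Well_order (Restr r (Field r - {m}))" by (simp add: ordLess_def)
    have "t \<in> fam_otimes (schreier_gen \<beta> (Restr r (Field r - {m}))) schreier"
    proof (rule fam_otimes_subset)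
      show "\<And>s. s \<in> schreier_gen \<beta> (Restr r (Field r - {m})) \<Longrightarrow> finite s \<and> s \<subseteq> {1..}"
        by (rule schreier_gen_finite[OF w])
      show "s \<in> fam_otimes (schreier_gen \<beta> (Restr r (Field r - {m}))) schreier"
        using less.prems unfolding schreier_gen_max[OF less.hyps 2] by simp
      show "t \<subseteq> s" "t \<noteq> {}" using less.prems by auto
    qed (rule less.IH[OF *])
    then show ?thesis unfolding schreier_gen_max[OF less.hyps 2] .
  next
    case 3
    then show ?thesis
      using less.prems less.IH[OF fund_wo[OF less.hyps 3] _ less.prems(2,3)]
      unfolding schreier_gen_limit[OF 3] by blast
  qed
qed

lemma schreier_gen_nonempty:
  assumes "Well_order r"
  shows "schreier_gen \<beta> r \<noteq> {}"
proof -
  have "{2} \<in> schreier_gen \<beta> r"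
    using assms
  proof (induction r rule: Well_order_induct)
    case (less r)
    show ?case
    proof (cases rule: ord_cases[of r])
      case 1 then show ?thesis by (simp add: schreier_gen_empty)
    next
      case (2 m)
      have *: "Restr r (Field r - {m}) <o r" using Restr_ord_is_max_ordLess[OF less.hyps 2] .
      then have "Well_order (Restr r (Field r - {m}))" by (simp add: ordLess_def)
      then show ?thesis
        unfolding schreier_gen_max[OF less.hyps 2]
        by (intro fam_otimes_schreier_superset[OF schreier_gen_finite] less.IH[OF *]) auto
    next
      case 3
      have "{2} \<in> schreier_gen \<beta> (\<beta> r 1)" using less.IH fund_wo[OF less.hyps 3] by blast
      then show ?thesis unfolding schreier_gen_limit[OF 3] by (auto intro!: bexI[of _ 1])
    qed
  qed
  then show ?thesis by blast
qed

text \<open>Keeping the factor \<open>schreier\<close> in the claim makes the induction close: at a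
  successor either \<open>q\<close> is the predecessor and the claim is the recursion itself, or the
  hypothesis puts the union into the predecessor family, whose nonempty sets are admissible as a
  single block.\<close>

lemma schreier_gen_ordLess:
  assumes "Well_order r" "q <o r"
  shows "\<exists>m. \<forall>s\<in>fam_otimes (schreier_gen \<beta> q) schreier. s \<subseteq> {m..} \<longrightarrow> s \<in> schreier_gen \<beta> r"
  using assms
proof (induction r arbitrary: q rule: Well_order_induct)
  case (less r)
  show ?case
  proof (cases rule: ord_cases[of r])
    case 1
    then show ?thesis using less.prems
      by (metis not_psubset_empty internalize_ordLess)
  next
    case (2 m)
    define p where "p = Restr r (Field r - {m})"
    have p: "p <o r" using Restr_ord_is_max_ordLess[OF less.hyps 2] by (simp add: p_def)
    then have wp: "Well_order p" by (simp add: ordLess_def)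
    have S: "schreier_gen \<beta> r = fam_otimes (schreier_gen \<beta> p) schreier"
      using schreier_gen_max[OF less.hyps 2] by (simp add: p_def)
    have "q \<le>o p" using ordLess_imp_ordLeq_Restr_ord_is_max[OF less.hyps 2 less.prems] p_def by simp
    then consider "q =o p" | "q <o p" using ordLeq_iff_ordLess_or_ordIso by blast
    then show ?thesis
    proof cases
      case 1 then show ?thesis using S schreier_gen_ordIso by auto
    next
      case 2
      have wq: "Well_order q" using 2 by (simp add: ordLess_def)
      obtain k where k: "\<And>s. s \<in> fam_otimes (schreier_gen \<beta> q) schreier \<Longrightarrow> s \<subseteq> {k..} \<Longrightarrow> s \<in> schreier_gen \<beta> p"
        using less.IH[OF p 2] by blast
      then have "s \<in> schreier_gen \<beta> r" if "s \<in> fam_otimes (schreier_gen \<beta> q) schreier" "s \<subseteq> {k..}" for s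
        using that S fam_otimes_schreier_superset[OF schreier_gen_finite[OF wp]]
          fam_otimes_finite[OF schreier_gen_finite[OF wq]] by blast
      then show ?thesis by blast
    qed
  next
    case 3
    obtain n where n: "n \<ge> 1" "q \<le>o \<beta> r n" using fund_sup[OF less.hyps 3 less.prems] by blast
    \<comment> \<open>One term further along the sequence, since \<open>q\<close> may be isomorphic
      to \<open>\<beta> r n\<close> and the induction hypothesis needs it strictly below.\<close>
    have q: "q <o \<beta> r (Suc n)"
      using n(2) fund_incr[OF less.hyps 3 n(1)] by (rule ordLeq_ordLess_trans)
    obtain k where k: "\<And>s. s \<in> fam_otimes (schreier_gen \<beta> q) schreier \<Longrightarrow> s \<subseteq> {k..} \<Longrightarrow>
        s \<in> schreier_gen \<beta> (\<beta> r (Suc n))"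
      using less.IH[OF fund_wo[OF less.hyps 3] q] by blast
    have "s \<in> schreier_gen \<beta> r"
      if "s \<in> fam_otimes (schreier_gen \<beta> q) schreier" "s \<subseteq> {max k (Suc n + 1)..}" for s
    proof -
      have "s \<subseteq> {k..}" "s \<subseteq> {Suc n + 1..}" using that(2) by auto
      then show ?thesis unfolding schreier_gen_limit[OF 3] using k[OF that(1)] by auto
    qed
    then show ?thesis by blast
  qed
qed

end

section \<open>Norm bounds on sequence spaces\<close>

abbreviation asum :: "(nat \<Rightarrow> real) \<Rightarrow> nat set \<Rightarrow> real" where
  "asum x s \<equiv> (\<Sum>n\<in>s. \<bar>x n\<bar>)"

lemma asum_mono: "finite t \<Longrightarrow> s \<subseteq> t \<Longrightarrow> asum x s \<le> asum x t"
  by (intro sum_mono2) auto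

lemma asum_Union_le:
  assumes "finite T" "\<And>t. t \<in> T \<Longrightarrow> finite t"
  shows "asum x (\<Union>T) \<le> (\<Sum>t\<in>T. asum x t)"
  using assms
proof (induction T rule: finite_induct)
  case (insert t T)
  have "asum x (t \<union> \<Union>T) \<le> asum x t + asum x (\<Union>T)"
    using insert by (subst sum.union_inter[symmetric]) (auto intro: sum_nonneg)
  then show ?case using insert by simp
qed simp

lemma asum_sum_le: "asum (\<lambda>m. \<Sum>i\<in>I. c i * v i m) s \<le> (\<Sum>i\<in>I. \<bar>c i\<bar> * asum (v i) s)"
proof -
  have "asum (\<lambda>m. \<Sum>i\<in>I. c i * v i m) s \<le> (\<Sum>n\<in>s. \<Sum>i\<in>I. \<bar>c i\<bar> * \<bar>v i n\<bar>)"
    by (intro sum_mono order_trans[OF sum_abs]) (simp add: abs_mult)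
  also have "\<dots> = (\<Sum>i\<in>I. \<bar>c i\<bar> * asum (v i) s)"
    by (subst sum.swap) (simp add: sum_distrib_left)
  finally show ?thesis .
qed

lemma asum_add_le: "asum (\<lambda>m. x m + y m) s \<le> asum x s + asum y s"
  by (subst sum.distrib[symmetric]) (intro sum_mono abs_triangle_ineq)

lemma asum_diff_le: "asum (\<lambda>m. x m - y m) s \<le> asum x s + asum y s"
  by (subst sum.distrib[symmetric]) (intro sum_mono abs_triangle_ineq4)

lemma asum_tendsto:
  assumes "\<And>m. (\<lambda>n. x n m) \<longlonglongrightarrow> y m"
  shows "(\<lambda>n. asum (x n) s) \<longlonglongrightarrow> asum y s"
  by (intro tendsto_intros assms)

section \<open>Cesaro means, subsequences and gliding humps\<close>

lemma cesaro_tendsto: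
  fixes x :: "nat \<Rightarrow> real"
  assumes "x \<longlonglongrightarrow> L"
  shows "(\<lambda>n. (\<Sum>i<Suc n. x i) / real (Suc n)) \<longlonglongrightarrow> L"
proof (rule LIMSEQ_I)
  fix e :: real assume e: "e > 0"
  then obtain N where N: "\<And>n. n \<ge> N \<Longrightarrow> \<bar>x n - L\<bar> < e / 2"
    using LIMSEQ_D[OF assms, of "e / 2"] by auto
  define S where "S = (\<Sum>i<N. \<bar>x i - L\<bar>)"
  obtain M :: nat where M: "2 * S / e < M" using reals_Archimedean2 by blast
  have "norm ((\<Sum>i<Suc n. x i) / real (Suc n) - L) < e" if n: "n \<ge> max N M" for n
  proof -
    have "(\<Sum>i<Suc n. x i) / real (Suc n) - L = (\<Sum>i<Suc n. x i - L) / real (Suc n)"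
      by (simp add: sum_subtractf field_simps del: sum.lessThan_Suc)
    moreover have "\<bar>\<Sum>i<Suc n. x i - L\<bar> \<le> S + (\<Sum>i=N..<Suc n. e / 2)"
    proof -
      have "\<bar>\<Sum>i<Suc n. x i - L\<bar> \<le> (\<Sum>i<Suc n. \<bar>x i - L\<bar>)" by (rule sum_abs)
      also have "\<dots> = S + (\<Sum>i=N..<Suc n. \<bar>x i - L\<bar>)"
      proof -
        have "(\<Sum>i<Suc n. \<bar>x i - L\<bar>) = (\<Sum>i\<in>{..<N} \<union> {N..<Suc n}. \<bar>x i - L\<bar>)"
          using n by (intro sum.cong) auto
        also have "\<dots> = S + (\<Sum>i=N..<Suc n. \<bar>x i - L\<bar>)"
          unfolding S_def by (rule sum.union_disjoint) auto
        finally show ?thesis .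
      qed
      also have "\<dots> \<le> S + (\<Sum>i=N..<Suc n. e / 2)"
        using N by (intro add_left_mono sum_mono) (auto intro: less_imp_le)
      finally show ?thesis .
    qed
    moreover have "(\<Sum>i=N..<Suc n. e / 2) \<le> real (Suc n) * (e / 2)"
      using e by (simp add: of_nat_diff mult_right_mono)
    moreover have "S < real (Suc n) * (e / 2)"
    proof -
      have "2 * S / e < real (Suc n)" using M n by linarith
      then show ?thesis using e by (simp add: field_simps)
    qed
    ultimately have "\<bar>\<Sum>i<Suc n. x i - L\<bar> < real (Suc n) * e"
      by (simp add: field_simps del: sum.lessThan_Suc)
    then show ?thesis
      unfolding \<open>(\<Sum>i<Suc n. x i) / real (Suc n) - L = _\<close>
      by (simp add: divide_less_eq abs_divide mult.commute del: sum.lessThan_Suc)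
  qed
  then show "\<exists>no. \<forall>n\<ge>no. norm ((\<Sum>i<Suc n. x i) / real (Suc n) - L) < e" by blast
qed

lemma pointwise_convergent_subsequence:
  fixes x :: "nat \<Rightarrow> nat \<Rightarrow> real"
  assumes "\<And>n m. \<bar>x n m\<bar> \<le> C"
  obtains h y where "strict_mono (h :: nat \<Rightarrow> nat)" "\<And>m. (\<lambda>n. x (h n) m) \<longlonglongrightarrow> y m"
proof -
  obtain h where "strict_mono (h :: nat \<Rightarrow> nat)" "\<And>m. \<exists>l. (\<lambda>n. x (h n) m) \<longlonglongrightarrow> l"
    using function_convergent_subsequence[of UNIV x C] assms by auto
  then show ?thesis using that by metis
qed

text \<open>\<open>Q\<close> says that for a given left end all late indices are good,
  \<open>R\<close> that for a given index all late right ends are good. Choosing index and end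
  alternately satisfies both; since \<open>R\<close> links an index to the next end, the choice runs
  over pairs. The stage \<open>l\<close> lets the tolerated errors shrink.\<close>

lemma gliding_hump:
  assumes Q: "\<And>l k :: nat. \<forall>\<^sub>F n in sequentially. Q l k n"
    and R: "\<And>l n :: nat. \<forall>\<^sub>F k in sequentially. R l n k"
  obtains g k :: "nat \<Rightarrow> nat" where "strict_mono g" "strict_mono k" "k 0 = k0"
    "\<And>l. Q l (k l) (g l)" "\<And>l. R l (g l) (k (Suc l))"
proof -
  have "\<exists>f. \<forall>l. (case f l of (k, n) \<Rightarrow> Q l k n \<and> (l = 0 \<longrightarrow> k = k0)) \<and>
      (case (f l, f (Suc l)) of ((k, n), (k', n')) \<Rightarrow> k < k' \<and> n < n' \<and> R l n k')"
  proof (rule dependent_nat_choice)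
    show "\<exists>x. case x of (k, n) \<Rightarrow> Q 0 k n \<and> ((0::nat) = 0 \<longrightarrow> k = k0)"
      using eventually_happens[OF Q[of 0 k0]] by auto
    fix x l assume "case x of (k, n) \<Rightarrow> Q l k n \<and> (l = 0 \<longrightarrow> k = k0)"
    obtain k n where x: "x = (k, n)" by force
    obtain k' where k': "k < k'" "R l n k'"
      using eventually_happens[OF eventually_conj[OF R[of l n] eventually_gt_at_top[of k]]] by auto
    obtain n' where n': "n < n'" "Q (Suc l) k' n'"
      using eventually_happens[OF eventually_conj[OF Q[of "Suc l" k'] eventually_gt_at_top[of n]]]
      by auto
    show "\<exists>y. (case y of (k, n) \<Rightarrow> Q (Suc l) k n \<and> (Suc l = 0 \<longrightarrow> k = k0)) \<and>
        (case (x, y) of ((k, n), (k', n')) \<Rightarrow> k < k' \<and> n < n' \<and> R l n k')"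
      by (rule exI[of _ "(k', n')"]) (use x k' n' in auto)
  qed
  then obtain f where f: "\<And>l. (case f l of (k, n) \<Rightarrow> Q l k n \<and> (l = 0 \<longrightarrow> k = k0)) \<and>
      (case (f l, f (Suc l)) of ((k, n), (k', n')) \<Rightarrow> k < k' \<and> n < n' \<and> R l n k')" by blast
  show ?thesis
  proof (rule that[of "snd \<circ> f" "fst \<circ> f"])
    show "strict_mono (snd \<circ> f)" "strict_mono (fst \<circ> f)"
      unfolding strict_mono_Suc_iff using f by (auto simp: case_prod_unfold)
  qed (use f in \<open>auto simp: case_prod_unfold\<close>)
qed

lemma sum_halves: "(\<Sum>l<m. c / 2 ^ (l + 1)) = c - c / 2 ^ m" for c :: real
  by (induction m) (auto simp: field_simps)

text \<open>The singletons account for the supremum norm, so that \<open>normF F\<close> is a single supremum over \<open>augment F\<close>.\<close>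

definition augment :: "nat set set \<Rightarrow> nat set set" where
  "augment F = insert {} (F \<union> range (\<lambda>n. {n}))"

text \<open>A bound instead of a value: the suprema in \<open>normF\<close> are meaningful only for
  bounded sequences, and with this predicate they have to be handled only when translating to and
  from \<open>normF\<close>.\<close>

definition norm_bound :: "nat set set \<Rightarrow> (nat \<Rightarrow> real) \<Rightarrow> real \<Rightarrow> bool" where
  "norm_bound F x c \<longleftrightarrow> (\<forall>s\<in>augment F. asum x s \<le> c)"

definition tail_null :: "nat set set \<Rightarrow> (nat \<Rightarrow> real) \<Rightarrow> bool" where
  "tail_null F x \<longleftrightarrow> (\<forall>e>0. \<exists>k. \<forall>s\<in>augment F. s \<subseteq> {k..} \<longrightarrow> asum x s \<le> e)"

definition cesaro_converges :: "nat set set \<Rightarrow> (nat \<Rightarrow> nat \<Rightarrow> real) \<Rightarrow> (nat \<Rightarrow> real) \<Rightarrow> bool" where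
  "cesaro_converges F x y \<longleftrightarrow> (\<forall>e>0. \<exists>N. \<forall>n\<ge>N.
     norm_bound F (\<lambda>m. (\<Sum>i<Suc n. x i m) / real (Suc n) - y m) e)"

lemma cesaro_convergesD:
  assumes "cesaro_converges F x y" "e > 0"
  obtains N where
    "\<And>n. n \<ge> N \<Longrightarrow> norm_bound F (\<lambda>m. (\<Sum>i<Suc n. x i m) / real (Suc n) - y m) e"
  using assms unfolding cesaro_converges_def by blast

lemma norm_boundD: "norm_bound F x c \<Longrightarrow> s \<in> augment F \<Longrightarrow> asum x s \<le> c"
  by (simp add: norm_bound_def)

lemma norm_bound_nonneg: "norm_bound F x c \<Longrightarrow> 0 \<le> c"
  using norm_boundD[of F x c "{}"] by (simp add: augment_def)

lemma norm_bound_abs: "norm_bound F x c \<Longrightarrow> \<bar>x m\<bar> \<le> c"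
  using norm_boundD[of F x c "{m}"] by (simp add: augment_def)

lemma norm_bound_mono: "norm_bound F x c \<Longrightarrow> c \<le> d \<Longrightarrow> norm_bound F x d"
  by (fastforce simp: norm_bound_def)

lemma norm_bound_diff:
  "norm_bound F x c \<Longrightarrow> norm_bound F y d \<Longrightarrow> norm_bound F (\<lambda>m. x m - y m) (c + d)"
  unfolding norm_bound_def by (blast intro: order_trans[OF asum_diff_le add_mono])

lemma norm_bound_add:
  "norm_bound F x c \<Longrightarrow> norm_bound F y d \<Longrightarrow> norm_bound F (\<lambda>m. x m + y m) (c + d)"
  unfolding norm_bound_def by (blast intro: order_trans[OF asum_add_le add_mono])

lemma norm_bound_cmult:
  assumes "norm_bound F x c"
  shows "norm_bound F (\<lambda>m. a * x m) (\<bar>a\<bar> * c)"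
  using assms unfolding norm_bound_def
  by (auto simp: abs_mult sum_distrib_left[symmetric] intro!: mult_left_mono)

lemma norm_bound_sum:
  assumes "\<And>i. i < k \<Longrightarrow> norm_bound F (v i) (C i)"
  shows "norm_bound F (\<lambda>m. \<Sum>i<k. c i * v i m) (\<Sum>i<k. \<bar>c i\<bar> * C i)"
  unfolding norm_bound_def
proof
  fix s assume s: "s \<in> augment F"
  have "asum (\<lambda>m. \<Sum>i<k. c i * v i m) s \<le> (\<Sum>i<k. \<bar>c i\<bar> * asum (v i) s)" by (rule asum_sum_le)
  also have "\<dots> \<le> (\<Sum>i<k. \<bar>c i\<bar> * C i)"
    using s assms by (intro sum_mono mult_left_mono norm_boundD) auto
  finally show "asum (\<lambda>m. \<Sum>i<k. c i * v i m) s \<le> (\<Sum>i<k. \<bar>c i\<bar> * C i)" .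
qed

lemma norm_bound_limit:
  assumes "\<And>n. norm_bound F (x n) C" "\<And>m. (\<lambda>n. x n m) \<longlonglongrightarrow> y m"
  shows "norm_bound F y C"
  unfolding norm_bound_def
proof
  fix s assume "s \<in> augment F"
  then show "asum y s \<le> C"
    using assms(1) by (intro LIMSEQ_le_const2[OF asum_tendsto[OF assms(2)]]) (auto simp: norm_bound_def)
qed

lemma tail_nullE:
  assumes "tail_null F x" "e > 0"
  obtains k where "\<And>s. s \<in> augment F \<Longrightarrow> s \<subseteq> {k..} \<Longrightarrow> asum x s \<le> e"
proof -
  have "\<exists>k. \<forall>s\<in>augment F. s \<subseteq> {k..} \<longrightarrow> asum x s \<le> e"
    using assms unfolding tail_null_def by simp
  then show thesis using that by auto
qed

lemma tail_null_diff:
  assumes "tail_null F x" "tail_null F y"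
  shows "tail_null F (\<lambda>m. x m - y m)"
  unfolding tail_null_def
proof (intro allI impI)
  fix e :: real assume "e > 0"
  then obtain k k' where "\<And>s. s \<in> augment F \<Longrightarrow> s \<subseteq> {k..} \<Longrightarrow> asum x s \<le> e / 2"
      "\<And>s. s \<in> augment F \<Longrightarrow> s \<subseteq> {k'..} \<Longrightarrow> asum y s \<le> e / 2"
    using assms unfolding tail_null_def by (meson half_gt_zero)
  then have "asum x s \<le> e / 2" "asum y s \<le> e / 2"
    if "s \<in> augment F" "s \<subseteq> {max k k'..}" for s
    using that by (meson atLeast_subset_iff max.cobounded1 max.cobounded2 subset_trans)+
  then have "asum (\<lambda>m. x m - y m) s \<le> e" if "s \<in> augment F" "s \<subseteq> {max k k'..}" for s
    using that asum_diff_le[of x y s] by (smt (verit) field_sum_of_halves)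
  then show "\<exists>k. \<forall>s\<in>augment F. s \<subseteq> {k..} \<longrightarrow> asum (\<lambda>m. x m - y m) s \<le> e" by blast
qed

lemma tail_null_cmult:
  assumes "tail_null F x"
  shows "tail_null F (\<lambda>m. a * x m)"
  unfolding tail_null_def
proof (intro allI impI)
  fix e :: real assume e: "e > 0"
  then have "e / (\<bar>a\<bar> + 1) > 0" by (simp add: add_nonneg_pos)
  then obtain k where k: "\<And>s. s \<in> augment F \<Longrightarrow> s \<subseteq> {k..} \<Longrightarrow> asum x s \<le> e / (\<bar>a\<bar> + 1)"
    using assms[unfolded tail_null_def, rule_format] by metis
  have "asum (\<lambda>m. a * x m) s \<le> e" if "s \<in> augment F" "s \<subseteq> {k..}" for s
  proof -
    have "asum (\<lambda>m. a * x m) s = \<bar>a\<bar> * asum x s" by (simp add: abs_mult sum_distrib_left)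
    also have "\<dots> \<le> (\<bar>a\<bar> + 1) * (e / (\<bar>a\<bar> + 1))"
      using k[OF that] by (intro mult_mono) (auto intro: sum_nonneg)
    also have "\<dots> = e" by simp
    finally show ?thesis .
  qed
  then show "\<exists>k. \<forall>s\<in>augment F. s \<subseteq> {k..} \<longrightarrow> asum (\<lambda>m. a * x m) s \<le> e" by blast
qed

lemma tail_null_sum:
  "(\<And>i. i < k \<Longrightarrow> tail_null F (v i)) \<Longrightarrow> tail_null F (\<lambda>m. \<Sum>i<(k::nat). c i * v i m)"
proof (induction k)
  case 0 then show ?case by (auto simp: tail_null_def)
next
  case (Suc k)
  have "tail_null F (\<lambda>m. (\<Sum>i<k. c i * v i m) - (- c k) * v k m)"
    using Suc by (intro tail_null_diff tail_null_cmult) auto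
  then show ?case by simp
qed

lemma conv_setE:
  assumes "y \<in> conv_set A"
  obtains k :: nat and c :: "nat \<Rightarrow> real" and v :: "nat \<Rightarrow> nat \<Rightarrow> real" where "\<And>i. i < k \<Longrightarrow> 0 \<le> c i" "\<And>i. i < k \<Longrightarrow> v i \<in> A" "(\<Sum>i<k. c i) = 1"
    "y = (\<lambda>m. \<Sum>i<(k::nat). c i * v i m)"
proof -
  have "\<exists>k c v. (\<forall>i<(k::nat). 0 \<le> c i \<and> v i \<in> A) \<and> (\<Sum>i<k. c i) = 1 \<and> y = (\<lambda>m. \<Sum>i<k. c i * v i m)"
    using assms unfolding conv_set_def by (rule CollectD)
  then obtain k :: nat and c :: "nat \<Rightarrow> real" and v :: "nat \<Rightarrow> nat \<Rightarrow> real" where *: "\<forall>i<k. 0 \<le> c i \<and> v i \<in> A" "(\<Sum>i<k. c i) = 1"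
      "y = (\<lambda>m. \<Sum>i<k. c i * v i m)"
    by (elim exE conjE)
  show thesis by (rule that[OF _ _ *(2,3)]) (use *(1) in auto)
qed

locale hereditary_family =
  fixes F :: "nat set set"
  assumes nonempty: "F \<noteq> {}"
    and finite_sets: "s \<in> F \<Longrightarrow> finite s \<and> s \<subseteq> {1..}"
    and hereditary: "s \<in> F \<Longrightarrow> t \<subseteq> s \<Longrightarrow> t \<noteq> {} \<Longrightarrow> t \<in> F"
begin

lemma augment_finite: "s \<in> augment F \<Longrightarrow> finite s"
  using finite_sets by (auto simp: augment_def)

lemma augment_hereditary: "s \<in> augment F \<Longrightarrow> t \<subseteq> s \<Longrightarrow> t \<in> augment F"
  using hereditary by (auto simp: augment_def subset_singleton_iff)

lemma bdd_above_iff_norm_bound: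
  "bdd_above (range (\<lambda>n. \<bar>x n\<bar>)) \<and> bdd_above ((\<lambda>s. asum x s) ` F) \<longleftrightarrow> (\<exists>C. norm_bound F x C)"
proof
  assume "bdd_above (range (\<lambda>n. \<bar>x n\<bar>)) \<and> bdd_above ((\<lambda>s. asum x s) ` F)"
  then obtain a b where ab: "\<And>n. \<bar>x n\<bar> \<le> a" "\<And>s. s \<in> F \<Longrightarrow> asum x s \<le> b"
    by (auto simp: bdd_above_def)
  have "0 \<le> a" using ab(1)[of 0] by linarith
  then have "norm_bound F x (max a b)"
    using ab unfolding norm_bound_def augment_def by (auto simp: le_max_iff_disj)
  then show "\<exists>C. norm_bound F x C" ..
next
  assume "\<exists>C. norm_bound F x C"
  then obtain C where C: "norm_bound F x C" ..
  then show "bdd_above (range (\<lambda>n. \<bar>x n\<bar>)) \<and> bdd_above ((\<lambda>s. asum x s) ` F)"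
    using norm_bound_abs[OF C] norm_boundD[OF C]
    by (auto simp: bdd_above_def augment_def)
qed

lemma normF_le_iff:
  assumes "norm_bound F x C" "0 \<le> c"
  shows "normF F x \<le> c \<longleftrightarrow> norm_bound F x c"
proof -
  have "bdd_above (range (\<lambda>n. \<bar>x n\<bar>))" "bdd_above ((\<lambda>s. asum x s) ` F)"
    using assms(1) bdd_above_iff_norm_bound[of x] by auto
  then have "normF F x \<le> c \<longleftrightarrow> (\<forall>n. \<bar>x n\<bar> \<le> c) \<and> (\<forall>s\<in>F. asum x s \<le> c)"
    using nonempty by (simp add: normF_def cSUP_le_iff)
  also have "\<dots> \<longleftrightarrow> norm_bound F x c"
    using assms(2) by (simp add: norm_bound_def augment_def ball_Un conj_commute)
  finally show ?thesis .
qed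

lemma normF_nonneg:
  assumes "norm_bound F x C"
  shows "0 \<le> normF F x"
proof -
  have "bdd_above (range (\<lambda>n. \<bar>x n\<bar>))"
    using assms bdd_above_iff_norm_bound[of x] by auto
  then have "\<bar>x 0\<bar> \<le> (SUP n. \<bar>x n\<bar>)" by (intro cSUP_upper) auto
  then show ?thesis unfolding normF_def by linarith
qed

lemma normF_tendsto_0_iff:
  assumes "\<And>n. \<exists>C. norm_bound F (x n) C"
  shows "(\<lambda>n. normF F (x n)) \<longlonglongrightarrow> 0 \<longleftrightarrow> (\<forall>e>0. \<exists>N. \<forall>n\<ge>N. norm_bound F (x n) e)"
proof -
  have nb: "normF F (x n) \<le> e \<longleftrightarrow> norm_bound F (x n) e" if "e > 0" for n e
    using assms[of n] normF_le_iff that by (meson less_imp_le)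
  have nn: "norm (normF F (x n) - 0) = normF F (x n)" for n
    using assms[of n] normF_nonneg by auto
  show ?thesis unfolding LIMSEQ_iff nn
  proof safe
    fix e :: real assume "\<forall>r>0. \<exists>no. \<forall>n\<ge>no. normF F (x n) < r" "0 < e"
    then show "\<exists>N. \<forall>n\<ge>N. norm_bound F (x n) e" using nb by (meson less_imp_le)
  next
    fix e :: real assume "\<forall>e>0. \<exists>N. \<forall>n\<ge>N. norm_bound F (x n) e" "0 < e"
    then obtain N where "\<forall>n\<ge>N. norm_bound F (x n) (e / 2)" by (meson half_gt_zero)
    then have "\<forall>n\<ge>N. normF F (x n) \<le> e / 2" using nb[of "e / 2"] \<open>0 < e\<close> by simp
    moreover have "e / 2 < e" using \<open>0 < e\<close> by simp
    ultimately have "\<forall>n\<ge>N. normF F (x n) < e" by (meson order_le_less_trans)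
    then show "\<exists>no. \<forall>n\<ge>no. normF F (x n) < e" ..
  qed
qed

lemma asum_tail:
  assumes "finite s"
  shows "asum (\<lambda>n. if n < k then 0 else x n) s = asum x (s \<inter> {k..})"
proof -
  have "asum (\<lambda>n. if n < k then 0 else x n) s = (\<Sum>n\<in>s. if n \<in> {k..} then \<bar>x n\<bar> else 0)"
    by (intro sum.cong) auto
  then show ?thesis using assms by (simp add: sum.inter_restrict)
qed

lemma norm_bound_tail_iff:
  "norm_bound F (\<lambda>n. if n < k then 0 else x n) c \<longleftrightarrow>
    (\<forall>s\<in>augment F. s \<subseteq> {k..} \<longrightarrow> asum x s \<le> c)"
proof -
  have "norm_bound F (\<lambda>n. if n < k then 0 else x n) c \<longleftrightarrow>
      (\<forall>s\<in>augment F. asum x (s \<inter> {k..}) \<le> c)"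
    unfolding norm_bound_def using asum_tail augment_finite by auto
  also have "\<dots> \<longleftrightarrow> (\<forall>s\<in>augment F. s \<subseteq> {k..} \<longrightarrow> asum x s \<le> c)"
    by (metis Int_absorb2 Int_lower1 Int_lower2 augment_hereditary)
  finally show ?thesis .
qed

text \<open>Because \<open>augment F\<close> is hereditary, truncating \<open>x\<close> at
  \<open>k\<close> amounts to testing it only on sets inside \<open>{k..}\<close>; this turns
  norm-null tails into \<open>tail_null\<close>.\<close>

lemma XF_iff: "x \<in> XF F \<longleftrightarrow> x 0 = 0 \<and> (\<exists>C. norm_bound F x C) \<and> tail_null F x"
proof (cases "\<exists>C. norm_bound F x C")
  case True
  then obtain C where C: "norm_bound F x C" ..
  then have "norm_bound F (\<lambda>n. if n < k then 0 else x n) C" for k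
    unfolding norm_bound_tail_iff by (simp add: norm_bound_def)
  then have *: "\<exists>C. norm_bound F (\<lambda>n. if n < k then 0 else x n) C" for k by blast
  have "(\<lambda>k. normF F (\<lambda>n. if n < k then 0 else x n)) \<longlonglongrightarrow> 0 \<longleftrightarrow> tail_null F x"
    unfolding normF_tendsto_0_iff[OF *] norm_bound_tail_iff tail_null_def
    by (meson atLeast_subset_iff order_refl order_trans)
  then show ?thesis
    using True bdd_above_iff_norm_bound[of x] unfolding XF_def by auto
next
  case False
  then show ?thesis using bdd_above_iff_norm_bound[of x] unfolding XF_def by auto
qed

lemma XF_diff_bounded:
  assumes "x \<in> XF F" "y \<in> XF F"
  shows "\<exists>C. norm_bound F (\<lambda>m. x m - y m) C"
  using assms norm_bound_diff unfolding XF_iff by blast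

lemma XF_sum:
  assumes "\<And>i. i < k \<Longrightarrow> v i \<in> XF F"
  shows "(\<lambda>m. \<Sum>i<(k::nat). c i * v i m) \<in> XF F"
proof -
  have "\<forall>i. \<exists>C. i < k \<longrightarrow> norm_bound F (v i) C" using assms XF_iff by blast
  then obtain C where "\<And>i. i < k \<Longrightarrow> norm_bound F (v i) (C i)" by metis
  then have "norm_bound F (\<lambda>m. \<Sum>i<k. c i * v i m) (\<Sum>i<k. \<bar>c i\<bar> * C i)"
    by (rule norm_bound_sum)
  then show ?thesis using assms tail_null_sum[of k F v c] unfolding XF_iff by auto
qed

lemma XF_mean:
  assumes "\<And>n. x n \<in> XF F"
  shows "(\<lambda>m. (\<Sum>i<Suc n. x (g i) m) / real (Suc n)) \<in> XF F"
  using XF_sum[of "Suc n" "\<lambda>i. x (g i)" "\<lambda>_. 1 / real (Suc n)"] assms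
  by (simp only: sum_distrib_left[symmetric]) simp

lemma conv_set_subset_XF:
  assumes "A \<subseteq> XF F"
  shows "conv_set A \<subseteq> XF F"
  using assms by (auto simp: conv_set_def intro!: XF_sum)

lemma banach_saks_set_iff:
  assumes A: "A \<subseteq> XF F"
  shows "banach_saks_set F A \<longleftrightarrow> (\<forall>x :: nat \<Rightarrow> nat \<Rightarrow> real. (\<forall>n. x n \<in> A) \<longrightarrow>
    (\<exists>g y. strict_mono g \<and> y \<in> XF F \<and> cesaro_converges F (\<lambda>i. x (g i)) y))"
proof -
  have "(\<lambda>n. normF F (\<lambda>m. (\<Sum>i<Suc n. x (g i) m) / real (Suc n) - y m)) \<longlonglongrightarrow> 0 \<longleftrightarrow>
      cesaro_converges F (\<lambda>i. x (g i)) y"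
    if "\<forall>n. x n \<in> A" "y \<in> XF F" for x y and g :: "nat \<Rightarrow> nat"
    unfolding cesaro_converges_def
    using that A by (intro normF_tendsto_0_iff XF_diff_bounded XF_mean) auto
  then show ?thesis unfolding banach_saks_set_def by (simp cong: conj_cong)
qed

lemma banach_saks_setE:
  assumes "A \<subseteq> XF F" "banach_saks_set F A" "\<And>n. x n \<in> A"
  obtains g y where "strict_mono (g :: nat \<Rightarrow> nat)" "y \<in> XF F" "cesaro_converges F (\<lambda>i. x (g i)) y"
proof -
  have "\<forall>n. x n \<in> A" using assms(3) by blast
  from assms(2)[unfolded banach_saks_set_iff[OF assms(1)], THEN spec, THEN mp, OF this]
  show thesis by (elim exE conjE) (rule that)
qed

end

section \<open>Banach-Saks sets\<close>

context hereditary_family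
begin

text \<open>Norm convergence of the means implies convergence of each coordinate, where the means of
  a convergent sequence keep its limit. So the Cesaro limit can only be \<open>y\<close>, and
  Banach-Saks forces pointwise limits into the space.\<close>

lemma banach_saks_subsequence:
  assumes A: "A \<subseteq> XF F" "banach_saks_set F A" and x: "\<And>n. x n \<in> A"
    and y: "\<And>m. (\<lambda>n. x n m) \<longlonglongrightarrow> y m"
  obtains g where "strict_mono (g :: nat \<Rightarrow> nat)" "y \<in> XF F"
    "cesaro_converges F (\<lambda>i. x (g i)) y"
proof -
  obtain g y' where g: "strict_mono g" "y' \<in> XF F" and
    conv: "cesaro_converges F (\<lambda>i. x (g i)) y'"
    using banach_saks_setE[OF A x] .
  have "y' m = y m" for m
  proof (rule LIMSEQ_unique)
    have "(\<lambda>i. x (g i) m) \<longlonglongrightarrow> y m"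
      using LIMSEQ_subseq_LIMSEQ[OF y g(1)] by (simp add: comp_def)
    then show "(\<lambda>n. (\<Sum>i<Suc n. x (g i) m) / real (Suc n)) \<longlonglongrightarrow> y m"
      by (rule cesaro_tendsto)
    show "(\<lambda>n. (\<Sum>i<Suc n. x (g i) m) / real (Suc n)) \<longlonglongrightarrow> y' m"
    proof (rule LIMSEQ_I)
      fix e :: real assume "e > 0"
      then obtain N where "\<And>n. n \<ge> N \<Longrightarrow>
          norm_bound F (\<lambda>m. (\<Sum>i<Suc n. x (g i) m) / real (Suc n) - y' m) (e / 2)"
        using cesaro_convergesD[OF conv, of "e / 2"] by auto
      then have "\<forall>n\<ge>N. \<bar>(\<Sum>i<Suc n. x (g i) m) / real (Suc n) - y' m\<bar> \<le> e / 2"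
        using norm_bound_abs by blast
      moreover have "e / 2 < e" using \<open>e > 0\<close> by simp
      ultimately show "\<exists>no. \<forall>n\<ge>no. norm ((\<Sum>i<Suc n. x (g i) m) / real (Suc n) - y' m) < e"
        unfolding real_norm_def by (meson order_le_less_trans)
    qed
  qed
  then have "y' = y" by auto
  with g conv show ?thesis by (intro that) auto
qed

text \<open>A term of the subsequence is the difference of two consecutive partial sums. Convergent
  means let these grow at most linearly, which contradicts the quadratic growth arranged for the
  norms.\<close>

lemma banach_saks_bounded:
  assumes A: "A \<subseteq> XF F" "banach_saks_set F A"
  obtains C where "\<And>a. a \<in> A \<Longrightarrow> norm_bound F a C"
proof (rule ccontr)
  assume "\<not> thesis"
  then have "\<forall>n::nat. \<exists>a\<in>A. \<not> norm_bound F a ((real n)\<^sup>2)" using that by blast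
  then obtain x where x: "\<And>n. x n \<in> A" "\<And>n. \<not> norm_bound F (x n) ((real n)\<^sup>2)" by metis
  obtain g y where g: "strict_mono g" "y \<in> XF F" and
    conv: "cesaro_converges F (\<lambda>i. x (g i)) y"
    using banach_saks_setE[OF A x(1)] .
  obtain N where N: "\<And>n. n \<ge> N \<Longrightarrow>
      norm_bound F (\<lambda>m. (\<Sum>i<Suc n. x (g i) m) / real (Suc n) - y m) 1"
    using cesaro_convergesD[OF conv, of 1] by auto
  obtain D where D: "norm_bound F y D" using g(2) XF_iff by blast
  define K where "K = 1 + D"
  have K: "norm_bound F (\<lambda>m. \<Sum>i<Suc n. x (g i) m) (real (Suc n) * K)" if "n \<ge> N" for n
    using norm_bound_cmult[OF norm_bound_add[OF N[OF that] D], of "real (Suc n)"]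
    by (simp add: K_def del: sum.lessThan_Suc)
  have K0: "K \<ge> 0" using norm_bound_nonneg[OF D] by (simp add: K_def)
  have le: "norm_bound F (x (g (Suc n))) (real (2 * n + 3) * K)" if "n \<ge> N" for n
  proof -
    have "norm_bound F (x (g (Suc n))) (real (Suc (Suc n)) * K + real (Suc n) * K)"
      using norm_bound_diff[OF K[of "Suc n"] K[of n]] that by simp
    then show ?thesis by (simp add: algebra_simps)
  qed
  obtain M :: nat where M: "2 * K + 1 \<le> real M" using real_arch_simple by blast
  define n where "n = max N M"
  have "real (2 * n + 3) * K \<le> (real (Suc n))\<^sup>2"
  proof -
    have "real (2 * n + 3) * K = (real n + 3 / 2) * (2 * K)" by (simp add: algebra_simps)
    also have "\<dots> \<le> (real n + 3 / 2) * (real n - 1)"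
      using M by (intro mult_left_mono) (auto simp: n_def)
    also have "\<dots> \<le> (real (Suc n))\<^sup>2" by (simp add: power2_eq_square algebra_simps)
    finally show ?thesis .
  qed
  moreover have "real (Suc n) \<le> real (g (Suc n))" using seq_suble[OF g(1)] by (simp del: of_nat_Suc)
  ultimately have "real (2 * n + 3) * K \<le> (real (g (Suc n)))\<^sup>2"
    by (meson of_nat_0_le_iff order_trans power_mono)
  with le[of n] x(2)[of "g (Suc n)"] show False
    using norm_bound_mono n_def by (metis max.cobounded1)
qed

lemma bounded_convergent_subsequence:
  assumes "\<And>n. norm_bound F (x n) C"
  obtains h y where "strict_mono (h :: nat \<Rightarrow> nat)" "\<And>m. (\<lambda>n. x (h n) m) \<longlonglongrightarrow> y m" "norm_bound F y C"
proof -
  obtain h y where "strict_mono (h :: nat \<Rightarrow> nat)" "\<And>m. (\<lambda>n. x (h n) m) \<longlonglongrightarrow> y m"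
    using pointwise_convergent_subsequence[of x C] norm_bound_abs[OF assms] by metis
  then show ?thesis using that norm_bound_limit[of F "\<lambda>n. x (h n)" C y] assms by blast
qed

lemma conv_set_bounded:
  assumes "\<And>a. a \<in> A \<Longrightarrow> norm_bound F a C" "y \<in> conv_set A"
  shows "norm_bound F y C"
proof -
  obtain k :: nat and c :: "nat \<Rightarrow> real" and v :: "nat \<Rightarrow> nat \<Rightarrow> real" where "\<And>i. i < k \<Longrightarrow> 0 \<le> c i" "\<And>i. i < k \<Longrightarrow> v i \<in> A" "(\<Sum>i<k. c i) = 1"
      "y = (\<lambda>m. \<Sum>i<k. c i * v i m)"
    by (rule conv_setE[OF assms(2)]) (rule that)
  moreover from this have "(\<Sum>i<k. \<bar>c i\<bar> * C) = C"
    by (simp add: sum_distrib_right[symmetric])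
  ultimately show ?thesis using norm_bound_sum[of k F v "\<lambda>_. C" c] assms(1) by simp
qed

end

text \<open>Through this convexity the estimate of \<open>lower_tails\<close> reaches the
  hull.\<close>

lemma conv_set_asum_le:
  assumes "\<And>a. a \<in> A \<Longrightarrow> asum a s \<le> e" "y \<in> conv_set A"
  shows "asum y s \<le> e"
proof -
  obtain k :: nat and c :: "nat \<Rightarrow> real" and v :: "nat \<Rightarrow> nat \<Rightarrow> real" where y: "\<And>i. i < k \<Longrightarrow> 0 \<le> c i" "\<And>i. i < k \<Longrightarrow> v i \<in> A" "(\<Sum>i<k. c i) = 1"
      "y = (\<lambda>m. \<Sum>i<k. c i * v i m)"
    by (rule conv_setE[OF assms(2)]) (rule that)
  have "asum y s \<le> (\<Sum>i<k. \<bar>c i\<bar> * asum (v i) s)" unfolding y(4) by (rule asum_sum_le)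
  also have "\<dots> \<le> (\<Sum>i<k. c i * e)"
    using y(1,2) assms(1) by (intro sum_mono) (simp add: mult_left_mono)
  also have "\<dots> = e" using y(3) by (simp add: sum_distrib_right[symmetric])
  finally show ?thesis .
qed

text \<open>The two sides of the argument: \<open>lower_otimes\<close> yields large norms from mass
  on lower sets, \<open>lower_cover\<close> yields small norms from its absence. The cover is
  required only beyond \<open>q\<close>, because finitely many coordinates are controlled by
  pointwise convergence. One number \<open>D\<close> bounds both how many sets are used and which
  families they come from.\<close>

locale schreier_like = hereditary_family F for F :: "nat set set" +
  fixes L :: "nat \<Rightarrow> nat set set"
  assumes lower_finite: "s \<in> L p \<Longrightarrow> finite s \<and> s \<subseteq> {1..}"
    and lower_hereditary: "s \<in> L p \<Longrightarrow> t \<subseteq> s \<Longrightarrow> t \<noteq> {} \<Longrightarrow> t \<in> L p"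
    and lower_otimes: "\<exists>m. \<forall>s\<in>fam_otimes (L p) schreier. s \<subseteq> {m..} \<longrightarrow> s \<in> F"
    and lower_cover: "\<exists>D. \<forall>s\<in>F. s \<noteq> {} \<longrightarrow> Min s \<le> q \<longrightarrow>
      (\<exists>T. finite T \<and> card T \<le> D \<and> T \<subseteq> (\<Union>p\<le>D. L p) \<and> s \<inter> {q<..} \<subseteq> \<Union>T)"
begin

lemma lower_subset: "\<exists>m. \<forall>s\<in>L p. s \<subseteq> {m..} \<longrightarrow> s \<in> augment F"
proof -
  obtain m where m: "\<And>s. s \<in> fam_otimes (L p) schreier \<Longrightarrow> s \<subseteq> {m..} \<Longrightarrow> s \<in> F"
    using lower_otimes[of p] by blast
  have "s \<in> augment F" if "s \<in> L p" "s \<subseteq> {m..}" for s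
    using m[OF fam_otimes_schreier_superset[of "L p", OF lower_finite that(1)] that(2)]
    by (cases "s = {}") (auto simp: augment_def)
  then show ?thesis by blast
qed

text \<open>Otherwise some elements carry mass above \<open>e\<close> on sets of \<open>L p\<close>
  moving to infinity. After subtracting a pointwise limit, a gliding hump makes these masses nearly
  disjoint. Any \<open>N\<close> of the sets that start beyond \<open>N\<close> have an admissible
  union, and on it the Cesaro means stay away from 0.\<close>

lemma lower_tails:
  assumes A: "A \<subseteq> XF F" "banach_saks_set F A" and e: "e > 0"
  shows "\<exists>k. \<forall>a\<in>A. \<forall>s\<in>L p. s \<subseteq> {k..} \<longrightarrow> asum a s \<le> e"
proof (rule ccontr)
  assume "\<not> ?thesis"
  then have "\<forall>k. \<exists>a s. a \<in> A \<and> s \<in> L p \<and> s \<subseteq> {k..} \<and> asum a s > e" by (meson not_le)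
  then obtain a s where a: "\<And>k. a k \<in> A" and s: "\<And>k. s k \<in> L p" "\<And>k. s k \<subseteq> {k..}"
    and as: "\<And>k. asum (a k) (s k) > e" by metis
  obtain C where "\<And>a. a \<in> A \<Longrightarrow> norm_bound F a C" using banach_saks_bounded[OF A] by blast
  then obtain h b where h: "strict_mono (h :: nat \<Rightarrow> nat)" "\<And>m. (\<lambda>n. a (h n) m) \<longlonglongrightarrow> b m"
    using bounded_convergent_subsequence[of a C] a by metis
  have bX: "b \<in> XF F"
    by (rule banach_saks_subsequence[OF A, of "\<lambda>n. a (h n)" b]) (use a h(2) in auto)
  obtain m where m: "\<And>s. s \<in> fam_otimes (L p) schreier \<Longrightarrow> s \<subseteq> {m..} \<Longrightarrow> s \<in> F"
    using lower_otimes[of p] by blast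
  obtain m' where m': "\<And>s. s \<in> L p \<Longrightarrow> s \<subseteq> {m'..} \<Longrightarrow> s \<in> augment F"
    using lower_subset[of p] by blast
  obtain k1 where k1: "\<And>s. s \<in> augment F \<Longrightarrow> s \<subseteq> {k1..} \<Longrightarrow> asum b s \<le> e / 2"
  proof (rule tail_nullE)
    show "tail_null F b" "e / 2 > 0" using bX e by (auto simp: XF_iff)
  qed (rule that)
  \<comment> \<open>The errors add up to at most \<open>e / 4\<close>, half of the mass
    \<open>e / 2\<close> that survives on each block once \<open>b\<close> is subtracted.\<close>
  define \<delta> where "\<delta> l = e / 4 / 2 ^ (l + 1)" for l :: nat
  have \<delta>0: "\<delta> l > 0" for l using e by (simp add: \<delta>_def)
  define z where "z n = (\<lambda>m. a (h n) m - b m)" for n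
  define \<sigma> where "\<sigma> n = s (h n)" for n
  have \<sigma>: "\<sigma> n \<in> L p" "\<sigma> n \<subseteq> {n..}" "finite (\<sigma> n)" "\<sigma> n \<noteq> {}" for n
    using s(1)[of "h n"] s(2)[of "h n"] seq_suble[OF h(1), of n] lower_finite as[of "h n"] e
    unfolding \<sigma>_def by auto
  have z0: "(\<lambda>n. z n m) \<longlonglongrightarrow> 0" for m
    using LIM_zero[OF h(2)[of m]] by (simp add: z_def)
  have tail: "tail_null F (z n)" for n
    using subsetD[OF A(1) a[of "h n"]] bX unfolding z_def by (intro tail_null_diff) (auto simp: XF_iff)
  obtain g k where gk: "strict_mono g" "strict_mono k" "k 0 = max (max m m') k1"
    and Q: "\<And>l. \<sigma> (g l) \<subseteq> {k l<..} \<and> asum (z (g l)) {..k l} \<le> \<delta> l"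
    and R: "\<And>l. \<sigma> (g l) \<subseteq> {..k (Suc l)} \<and> (\<forall>s\<in>augment F. s \<subseteq> {k (Suc l)..} \<longrightarrow> asum (z (g l)) s \<le> \<delta> l)"
  proof (rule gliding_hump[where
        Q = "\<lambda>l k n. \<sigma> n \<subseteq> {k<..} \<and> asum (z n) {..k} \<le> \<delta> l" and
        R = "\<lambda>l n k. \<sigma> n \<subseteq> {..k} \<and> (\<forall>s\<in>augment F. s \<subseteq> {k..} \<longrightarrow> asum (z n) s \<le> \<delta> l)" and
        ?k0.0 = "max (max m m') k1"])
    fix l k :: nat
    have "(\<lambda>n. asum (z n) {..k}) \<longlonglongrightarrow> asum (\<lambda>_. 0) {..k}" by (rule asum_tendsto[OF z0])
    then have "\<forall>\<^sub>F n in sequentially. asum (z n) {..k} < \<delta> l" using \<delta>0 by (intro order_tendstoD) auto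
    moreover have "\<forall>\<^sub>F n in sequentially. \<sigma> n \<subseteq> {k<..}"
      using eventually_gt_at_top[of k] by eventually_elim (use \<sigma>(2) in fastforce)
    ultimately show "\<forall>\<^sub>F n in sequentially. \<sigma> n \<subseteq> {k<..} \<and> asum (z n) {..k} \<le> \<delta> l"
      by eventually_elim simp
  next
    fix l n :: nat
    obtain k0 where "\<And>s. s \<in> augment F \<Longrightarrow> s \<subseteq> {k0..} \<Longrightarrow> asum (z n) s \<le> \<delta> l"
      by (rule tail_nullE[OF tail \<delta>0]) (rule that)
    then have "\<forall>k\<ge>k0. \<forall>s\<in>augment F. s \<subseteq> {k..} \<longrightarrow> asum (z n) s \<le> \<delta> l"
      by (meson atLeast_subset_iff subset_trans)
    then have "\<forall>\<^sub>F k in sequentially. \<forall>s\<in>augment F. s \<subseteq> {k..} \<longrightarrow> asum (z n) s \<le> \<delta> l"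
      unfolding eventually_sequentially by blast
    moreover have "\<forall>\<^sub>F k in sequentially. \<sigma> n \<subseteq> {..k}"
      using eventually_ge_at_top[of "Max (\<sigma> n)"]
      by eventually_elim (use \<sigma>(3)[of n] in \<open>auto intro: order_trans[OF Max_ge]\<close>)
    ultimately show "\<forall>\<^sub>F k in sequentially. \<sigma> n \<subseteq> {..k} \<and>
        (\<forall>s\<in>augment F. s \<subseteq> {k..} \<longrightarrow> asum (z n) s \<le> \<delta> l)"
      by eventually_elim simp
  qed blast
  \<comment> \<open>The Cesaro subsequence is extracted from the humps, not before them; their
    estimates survive because \<open>j \<le> u j\<close> and \<delta> decreases.\<close>
  obtain u where u: "strict_mono (u :: nat \<Rightarrow> nat)" and
    conv: "cesaro_converges F (\<lambda>i. a (h (g (u i)))) b"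
  proof (rule banach_saks_subsequence[OF A, of "\<lambda>n. a (h (g n))" b])
    show "(\<lambda>n. a (h (g n)) m) \<longlonglongrightarrow> b m" for m
      using LIMSEQ_subseq_LIMSEQ[OF h(2) gk(1)] by (simp add: comp_def)
  qed (use a in auto)
  define \<omega> where "\<omega> j = z (g (u j))" for j
  define \<nu> where "\<nu> i = \<sigma> (g (u i))" for i
  have k_ge: "k l \<ge> max (max m m') k1" "k l \<ge> l" for l
    using strict_mono_less_eq[OF gk(2), of 0 l] gk(3) seq_suble[OF gk(2)] by auto
  have \<nu>: "\<nu> i \<in> L p" "finite (\<nu> i)" "\<nu> i \<noteq> {}" "\<nu> i \<subseteq> {k (u i)<..k (Suc (u i))}" for i
    using \<sigma> Q[of "u i"] R[of "u i"] by (auto simp: \<nu>_def)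
  have \<nu>ge: "\<nu> i \<subseteq> {m..}" "\<nu> i \<subseteq> {m'..}" "\<nu> i \<subseteq> {k1..}" "\<nu> i \<subseteq> {i..}" "\<nu> i \<in> augment F" for i
  proof -
    show "\<nu> i \<subseteq> {m..}" and m: "\<nu> i \<subseteq> {m'..}" and "\<nu> i \<subseteq> {k1..}" using \<nu>(4)[of i] k_ge(1)[of "u i"] by force+
    show "\<nu> i \<subseteq> {i..}" using \<nu>(4)[of i] k_ge(2)[of "u i"] seq_suble[OF u, of i] by force
    show "\<nu> i \<in> augment F" using m'[OF \<nu>(1) m] .
  qed
  have k_u: "k (Suc (u i)) \<le> k (u j)" if "i < j" for i j
    using that u gk(2) by (simp add: strict_mono_less_eq Suc_leI strict_mono_less)
  have diag: "asum (\<omega> i) (\<nu> i) \<ge> e / 2" for i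
  proof -
    have "e < asum (a (h (g (u i)))) (\<nu> i)" using as by (simp add: \<nu>_def \<sigma>_def)
    also have "a (h (g (u i))) = (\<lambda>m. \<omega> i m + b m)" by (simp add: \<omega>_def z_def)
    also have "asum \<dots> (\<nu> i) \<le> asum (\<omega> i) (\<nu> i) + asum b (\<nu> i)" by (rule asum_add_le)
    also have "asum b (\<nu> i) \<le> e / 2" using k1 \<nu>ge by blast
    finally show ?thesis by simp
  qed
  have off: "asum (\<omega> j) (\<nu> i) \<le> \<delta> j" if "i \<noteq> j" for i j
  proof -
    have "asum (\<omega> j) (\<nu> i) \<le> \<delta> (u j)"
    proof (cases "i < j")
      case True
      have "\<nu> i \<subseteq> {..k (u j)}" using \<nu>(4)[of i] k_u[OF True] by force
      then have "asum (\<omega> j) (\<nu> i) \<le> asum (\<omega> j) {..k (u j)}" by (intro asum_mono) auto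
      then show ?thesis using Q[of "u j"] by (simp add: \<omega>_def)
    next
      case False
      then have "j < i" using that by simp
      then have "\<nu> i \<subseteq> {k (Suc (u j))..}" using \<nu>(4)[of i] k_u[of j i] by force
      then show ?thesis using R[of "u j"] \<nu>ge(5)[of i] by (auto simp: \<omega>_def)
    qed
    also have "\<delta> (u j) \<le> \<delta> j"
      using seq_suble[OF u, of j] e unfolding \<delta>_def
      by (intro divide_left_mono power_increasing) auto
    finally show ?thesis .
  qed
  \<comment> \<open>Half of the mass \<open>e / 8\<close> that the blocks below will force on the
    mean.\<close>
  obtain N0 where N0: "\<And>n. n \<ge> N0 \<Longrightarrow>
      norm_bound F (\<lambda>m. (\<Sum>i<Suc n. a (h (g (u i))) m) / real (Suc n) - b m) (e / 16)"
    using cesaro_convergesD[OF conv, of "e / 16"] e by auto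
  define N where "N = Suc N0"
  define M where "M = (\<lambda>m. (\<Sum>j<2 * N. \<omega> j m) / real (2 * N))"
  have M: "norm_bound F M (e / 16)"
  proof -
    have "M = (\<lambda>m. (\<Sum>i<Suc (2 * N - 1). a (h (g (u i))) m) / real (Suc (2 * N - 1)) - b m)"
      by (auto simp: M_def \<omega>_def z_def N_def sum_subtractf diff_divide_distrib simp del: sum.lessThan_Suc)
    then show ?thesis using N0[of "2 * N - 1"] by (simp add: N_def)
  qed
  \<comment> \<open>Only the second half of the \<open>2 * N\<close> blocks: block \<open>i\<close>
    lies in \<open>{i..}\<close>, so these \<open>N\<close> blocks start at \<open>N\<close> or
    later, as admissibility demands.\<close>
  define U where "U = (\<Union>i\<in>{N..<2 * N}. \<nu> i)"
  have disj: "Max (\<nu> i) < Min (\<nu> j)" if "i < j" for i j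
  proof -
    have "Max (\<nu> i) \<le> k (Suc (u i))" "k (u j) < Min (\<nu> j)"
      using \<nu>(2-4)[of i] \<nu>(2-4)[of j] Max_in[of "\<nu> i"] Min_in[of "\<nu> j"] by force+
    then show ?thesis using k_u[OF that] by linarith
  qed
  have "U \<in> F"
  proof (rule m)
    show "U \<in> fam_otimes (L p) schreier"
      unfolding fam_otimes_def
    proof (intro CollectI exI[of _ "map \<nu> [N..<2 * N]"] conjI)
      show "map \<nu> [N..<2 * N] \<noteq> []" by (simp add: N_def)
      show "sorted_wrt (\<lambda>a b. Max a < Min b) (map \<nu> [N..<2 * N])"
        unfolding sorted_wrt_map
        by (rule sorted_wrt_mono_rel[OF _ sorted_wrt_upt]) (use disj in auto)
      show "U = \<Union>(set (map \<nu> [N..<2 * N]))" by (simp add: U_def)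
      have ge: "N \<le> x" "1 \<le> x" if x: "x \<in> Min ` \<nu> ` {N..<2 * N}" for x
      proof -
        obtain i where "x = Min (\<nu> i)" "i \<ge> N" using x by auto
        then have "x \<in> \<nu> i" using \<nu>(2,3)[of i] by simp
        then show "N \<le> x" using \<nu>ge(4)[of i] \<open>i \<ge> N\<close> by force
        then show "1 \<le> x" by (simp add: N_def)
      qed
      have "card (Min ` \<nu> ` {N..<2 * N}) \<le> card {N..<2 * N}"
        by (simp only: image_image) (rule card_image_le, simp)
      also have "\<dots> = N" by simp
      also have "\<dots> \<le> Min (Min ` \<nu> ` {N..<2 * N})"
        using ge(1) by (intro Min.boundedI) (auto simp: N_def)
      finally show "Min ` set (map \<nu> [N..<2 * N]) \<in> schreier"
        using ge(2) by (auto simp: schreier_def)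
    qed (use \<nu> in auto)
    show "U \<subseteq> {m..}" using \<nu>ge(1) by (auto simp: U_def)
  qed
  then have "asum M U \<le> e / 16" using M by (auto simp: norm_bound_def augment_def)
  moreover have "asum M U = (\<Sum>i=N..<2 * N. asum M (\<nu> i))"
    unfolding U_def
  proof (rule sum.UNION_disjoint)
    show "\<forall>i\<in>{N..<2 * N}. \<forall>j\<in>{N..<2 * N}. i \<noteq> j \<longrightarrow> \<nu> i \<inter> \<nu> j = {}"
    proof (intro ballI impI)
      fix i j :: nat assume "i \<noteq> j"
      have *: "\<nu> i \<inter> \<nu> j = {}" if "i < j" for i j
        using disj[OF that] \<nu>(2)[of i] \<nu>(2)[of j]
        by (meson Max_ge Min_le disjoint_iff leD le_trans)
      show "\<nu> i \<inter> \<nu> j = {}" using *[of i j] *[of j i] \<open>i \<noteq> j\<close> by (metis Int_commute nat_neq_iff)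
    qed
  qed (use \<nu> in auto)
  \<comment> \<open>The own term gives at least \<open>e / 2\<close>, all others together at most
    \<open>e / 4\<close>; dividing by \<open>2 * N\<close> and adding over \<open>N\<close> blocks
    leaves \<open>e / 8\<close>.\<close>
  moreover have "asum M (\<nu> i) \<ge> (e / 4) / real (2 * N)" if i: "i \<in> {N..<2 * N}" for i
  proof -
    have "asum (\<omega> i) (\<nu> i) = asum (\<lambda>m. (\<Sum>j<2 * N. \<omega> j m) - (\<Sum>j\<in>{..<2 * N} - {i}. 1 * \<omega> j m)) (\<nu> i)"
      using i by (simp add: sum_diff1)
    also have "\<dots> \<le> asum (\<lambda>m. \<Sum>j<2 * N. \<omega> j m) (\<nu> i) + asum (\<lambda>m. \<Sum>j\<in>{..<2 * N} - {i}. 1 * \<omega> j m) (\<nu> i)"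
      by (rule asum_diff_le)
    also have "asum (\<lambda>m. \<Sum>j\<in>{..<2 * N} - {i}. 1 * \<omega> j m) (\<nu> i) \<le>
        (\<Sum>j\<in>{..<2 * N} - {i}. \<bar>1\<bar> * asum (\<omega> j) (\<nu> i))" by (rule asum_sum_le)
    also have "\<dots> \<le> (\<Sum>j\<in>{..<2 * N} - {i}. \<delta> j)" using off by (intro sum_mono) auto
    also have "\<dots> \<le> (\<Sum>j<2 * N. \<delta> j)" using \<delta>0 by (intro sum_mono2) (auto intro: less_imp_le)
    also have "\<dots> \<le> e / 4" unfolding \<delta>_def sum_halves using e by simp
    finally have "e / 4 \<le> asum (\<lambda>m. \<Sum>j<2 * N. \<omega> j m) (\<nu> i)" using diag[of i] by linarith
    moreover have "asum M (\<nu> i) = asum (\<lambda>m. \<Sum>j<2 * N. \<omega> j m) (\<nu> i) / real (2 * N)"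
      by (simp add: M_def abs_divide sum_divide_distrib[symmetric])
    ultimately show ?thesis by (metis divide_right_mono of_nat_0_le_iff)
  qed
  then have "(\<Sum>i=N..<2 * N. (e / 4) / real (2 * N)) \<le> (\<Sum>i=N..<2 * N. asum M (\<nu> i))"
    by (rule sum_mono)
  moreover have "(\<Sum>i=N..<2 * N. (e / 4) / real (2 * N)) = e / 8" by (simp add: N_def field_simps)
  ultimately show False using e by linarith
qed

end

section \<open>Pointwise limits of convex combinations\<close>

text \<open>This is the norm of the restriction of \<open>x\<close> to \<open>[k, j)\<close>. Only
  finitely many sets fit into the window, so it is a maximum, and pointwise convergence controls
  it.\<close>

definition window_norm :: "nat set set \<Rightarrow> nat \<Rightarrow> nat \<Rightarrow> (nat \<Rightarrow> real) \<Rightarrow> real" where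
  "window_norm F k j x = Max ((\<lambda>s. asum x s) ` {s \<in> augment F. s \<subseteq> {k..<j}})"

lemma finite_window: "finite {s \<in> augment F. s \<subseteq> {k..<j::nat}}"
  by (rule finite_subset[of _ "Pow {k..<j}"]) auto

lemma empty_in_window: "{} \<in> {s \<in> augment F. s \<subseteq> {k..<j::nat}}"
  by (simp add: augment_def)

lemma window_norm_le_iff:
  "window_norm F k j x \<le> c \<longleftrightarrow> (\<forall>s\<in>augment F. s \<subseteq> {k..<j} \<longrightarrow> asum x s \<le> c)"
  unfolding window_norm_def using finite_window empty_in_window
  by (subst Max_le_iff) (auto simp: augment_def)

lemma asum_le_window_norm: "s \<in> augment F \<Longrightarrow> s \<subseteq> {k..<j} \<Longrightarrow> asum x s \<le> window_norm F k j x"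
  using window_norm_le_iff[of F k j x "window_norm F k j x"] by simp

lemma window_norm_nonneg: "0 \<le> window_norm F k j x"
  using asum_le_window_norm[of "{}" F k j x] by (simp add: augment_def)

lemma window_norm_mono:
  assumes "k \<le> k'" "j' \<le> j"
  shows "window_norm F k' j' x \<le> window_norm F k j x"
  unfolding window_norm_le_iff
proof (intro ballI impI)
  fix s assume "s \<in> augment F" "s \<subseteq> {k'..<j'}"
  moreover from this have "s \<subseteq> {k..<j}" using assms by force
  ultimately show "asum x s \<le> window_norm F k j x" by (intro asum_le_window_norm)
qed

lemma convex_average_gt:
  fixes c \<phi> :: "nat \<Rightarrow> real"
  assumes "\<And>i. i < k \<Longrightarrow> 0 \<le> c i" "(\<Sum>i<k. c i) = 1" "b < (\<Sum>i<k. c i * \<phi> i)"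
  shows "\<exists>i<k. b < \<phi> i"
proof (rule ccontr)
  assume "\<not> ?thesis"
  then have "\<And>i. i < k \<Longrightarrow> \<phi> i \<le> b" by (meson not_less)
  then have "(\<Sum>i<k. c i * \<phi> i) \<le> (\<Sum>i<k. c i * b)"
    using assms(1) by (intro sum_mono mult_left_mono) auto
  then show False using assms(2,3) by (simp add: sum_distrib_right[symmetric])
qed

context hereditary_family
begin

text \<open>
  If \<open>z\<close> had nonvanishing tails, choose windows such that lengthening any of them increases the averaged
  window norm by little. Two consecutive windows then carry mass on almost the same elements, so a
  single element of \<open>A\<close> carries mass on arbitrarily many windows.
\<close>

lemma conv_set_pointwise_limit_XF:
  assumes A: "A \<subseteq> XF F" "banach_saks_set F A"
    and y: "\<And>n. y n \<in> conv_set A" and z: "\<And>m. (\<lambda>n. y n m) \<longlonglongrightarrow> z m"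
  shows "z \<in> XF F"
proof (rule ccontr)
  assume not: "z \<notin> XF F"
  obtain C where C: "\<And>a. a \<in> A \<Longrightarrow> norm_bound F a C" using banach_saks_bounded[OF A] by blast
  have yC: "norm_bound F (y n) C" for n using conv_set_bounded[OF C y] .
  have "z 0 = 0"
  proof -
    have "y n 0 = 0" for n
      using subsetD[OF conv_set_subset_XF[OF A(1)] y[of n]] by (simp add: XF_iff)
    then show ?thesis using z[of 0] by (simp add: LIMSEQ_const_iff)
  qed
  moreover have "norm_bound F z C" using norm_bound_limit[OF yC z] .
  ultimately have "\<not> tail_null F z" using not by (auto simp: XF_iff)
  then obtain e where e: "e > 0" "\<And>k. \<exists>s\<in>augment F. s \<subseteq> {k..} \<and> asum z s > e"
    unfolding tail_null_def by (meson not_le)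
  define R where "R n k c v \<longleftrightarrow> (\<forall>i<k. 0 \<le> c i \<and> v i \<in> A) \<and> (\<Sum>i<k. c i) = 1 \<and>
      y n = (\<lambda>m. \<Sum>i<k. c i * v i m)" for n k :: nat and c v
  have "\<exists>k c v. R n k c v" for n
    using y[of n] unfolding conv_set_def R_def by (rule CollectD)
  then obtain K c v where R: "\<And>n. R n (K n) (c n) (v n)" by metis
  have c: "\<And>n. \<forall>i<K n. 0 \<le> c n i" "\<And>n. (\<Sum>i<K n. c n i) = 1"
    and v: "\<And>n. \<forall>i<K n. v n i \<in> A" and y_eq: "\<And>n. y n = (\<lambda>m. \<Sum>i<K n. c n i * v n i m)"
    using R unfolding R_def by blast+
  \<comment> \<open>The coefficients representing \<open>y n\<close> act as a probability measure on
    \<open>A\<close>, and \<open>E n\<close> is its expectation. Averaging norms of elements,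
    instead of taking the norm of the average, retains information about individual
    elements.\<close>
  define E where "E n \<phi> = (\<Sum>i<K n. c n i * \<phi> (v n i))" for n and \<phi> :: "(nat \<Rightarrow> real) \<Rightarrow> real"
  have E_mono: "E n \<phi> \<le> E n \<psi>" if "\<And>a. a \<in> A \<Longrightarrow> \<phi> a \<le> \<psi> a" for n \<phi> \<psi>
    unfolding E_def using c(1) v that by (intro sum_mono mult_left_mono) auto
  have E_const: "E n (\<lambda>_. b) = b" for n b
    unfolding E_def using c(2) by (simp add: sum_distrib_right[symmetric])
  define T where "T n p = E n (window_norm F (fst p) (snd p))" for n and p :: "nat \<times> nat"
  have Tb: "\<bar>T n p\<bar> \<le> C" for n p
  proof -
    have "E n (\<lambda>_. 0) \<le> T n p" unfolding T_def using window_norm_nonneg by (intro E_mono)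
    moreover have "T n p \<le> E n (\<lambda>_. C)" unfolding T_def
      using C by (intro E_mono) (auto simp: window_norm_le_iff norm_bound_def)
    ultimately show ?thesis by (simp add: E_const)
  qed
  \<comment> \<open>There are countably many windows, so one diagonal subsequence makes all averaged
    window norms converge.\<close>
  obtain h where h: "strict_mono (h :: nat \<Rightarrow> nat)" "\<And>p. \<exists>l. (\<lambda>n. T (h n) p) \<longlonglongrightarrow> l"
    using function_convergent_subsequence[of UNIV T C] Tb by auto
  then obtain L where L: "\<And>p. (\<lambda>n. T (h n) p) \<longlonglongrightarrow> L p" by metis
  have L_mono: "L (k, j) \<le> L (k, j')" if "j \<le> j'" for k j j'
    by (rule LIMSEQ_le[OF L L]) (auto simp: T_def that intro!: E_mono window_norm_mono)
  have L_bound: "L p \<le> C" for p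
    using Tb by (intro LIMSEQ_le_const2[OF L]) (auto simp: abs_le_iff)
  have L_ge: "asum z s \<le> L (k, j)" if s: "s \<in> augment F" "s \<subseteq> {k..<j}" for s k j
  proof (rule LIMSEQ_le[OF _ L])
    show "(\<lambda>n. asum (y (h n)) s) \<longlonglongrightarrow> asum z s"
      using LIMSEQ_subseq_LIMSEQ[OF asum_tendsto[OF z] h(1)] by (simp add: comp_def)
    have "asum (y n) s \<le> T n (k, j)" for n
    proof -
      have "asum (y n) s \<le> (\<Sum>i<K n. \<bar>c n i\<bar> * asum (v n i) s)" unfolding y_eq by (rule asum_sum_le)
      also have "\<dots> = E n (\<lambda>a. asum a s)" unfolding E_def using c(1) by (intro sum.cong) auto
      also have "\<dots> \<le> T n (k, j)"
        unfolding T_def using asum_le_window_norm[OF s] by (intro E_mono) simp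
      finally show ?thesis .
    qed
    then show "\<exists>N. \<forall>n\<ge>N. asum (y (h n)) s \<le> T (h n) (k, j)" by blast
  qed
  define \<eta> where "\<eta> l = e / 2 / 2 ^ (l + 1)" for l :: nat
  have \<eta>0: "\<eta> l > 0" for l using e(1) by (simp add: \<eta>_def)
  \<comment> \<open>For fixed \<open>k\<close> the values \<open>L (k, j)\<close> increase in
    \<open>j\<close> and are bounded, so a late \<open>j\<close> comes within
    \<open>\<eta> l\<close> of their supremum; it also has to pass a set on which \<open>z\<close>
    exceeds \<open>e\<close>.\<close>
  have "\<exists>j>k. e < L (k, j) \<and> (\<forall>j'. L (k, j') \<le> L (k, j) + \<eta> l)" for k l
  proof -
    obtain s where s: "s \<in> augment F" "s \<subseteq> {k..}" "asum z s > e" using e(2) by blast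
    have bdd: "bdd_above (range (\<lambda>j. L (k, j)))" using L_bound by (auto simp: bdd_above_def)
    obtain j0 where j0: "(SUP j. L (k, j)) - \<eta> l < L (k, j0)"
      using less_cSUP_iff[OF _ bdd, of "(SUP j. L (k, j)) - \<eta> l"] \<eta>0[of l] by auto
    define j where "j = max (max j0 (Suc k)) (Suc (Max (insert 0 s)))"
    have "s \<subseteq> {k..<j}"
      using s(2) augment_finite[OF s(1)] Max_ge[of "insert 0 s"] by (force simp: j_def less_Suc_eq_le le_max_iff_disj less_max_iff_disj)
    then have "e < L (k, j)" using L_ge[OF s(1)] s(3) by force
    moreover have "L (k, j') \<le> L (k, j) + \<eta> l" for j'
    proof -
      have "L (k, j') \<le> (SUP j. L (k, j))" using bdd by (intro cSUP_upper) auto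
      moreover have "L (k, j0) \<le> L (k, j)" by (rule L_mono) (simp add: j_def)
      ultimately show ?thesis using j0 by linarith
    qed
    ultimately show ?thesis by (intro exI[of _ j]) (auto simp: j_def)
  qed
  then obtain J where J: "\<And>k l. k < J k l" "\<And>k l. e < L (k, J k l)"
      "\<And>k l j'. L (k, j') \<le> L (k, J k l) + \<eta> l" by metis
  define j where "j = rec_nat 0 (\<lambda>l k. J k l)"
  have j_Suc: "j (Suc l) = J (j l) l" for l by (simp add: j_def)
  have j_mono: "strict_mono j" unfolding strict_mono_Suc_iff using J(1) by (simp add: j_Suc)
  define N where "N l = window_norm F (j l) (j (Suc l))" for l
  \<comment> \<open>The gain from extending window \<open>l\<close> over the next one. That next
    window lies in the extension, so \<open>N (Suc l)\<close> exceeds \<open>N l\<close> by at most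
    this gain.\<close>
  define d where "d l a = window_norm F (j l) (j (Suc (Suc l))) a - N l a" for l a
  have d0: "0 \<le> d l a" and N_d: "N (Suc l) a \<le> N l a + d l a" for l a
    using j_mono by (auto simp: d_def N_def strict_mono_less_eq intro!: window_norm_mono)
  have "\<exists>a\<in>A. \<forall>l\<le>m. N l a > e / 2" for m
  proof -
    \<comment> \<open>In the limit \<open>N m\<close> averages above \<open>e\<close> and the gains
      together at most \<open>e / 2\<close>, so some element has \<open>\<Phi> a > e / 2\<close>.
      Going back from window \<open>m\<close> costs at most the subtracted gains, hence that element
      is large on all windows up to \<open>m\<close>.\<close>
    define \<Phi> where "\<Phi> a = N m a - (\<Sum>l<m. d l a)" for a
    have E_\<Phi>: "E n \<Phi> = T n (j m, j (Suc m)) -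
        (\<Sum>l<m. T n (j l, j (Suc (Suc l))) - T n (j l, j (Suc l)))" for n
    proof -
      have "E n \<Phi> = E n (N m) - (\<Sum>i<K n. \<Sum>l<m. c n i * d l (v n i))"
        by (simp add: E_def \<Phi>_def right_diff_distrib sum_subtractf sum_distrib_left)
      also have "(\<Sum>i<K n. \<Sum>l<m. c n i * d l (v n i)) = (\<Sum>l<m. \<Sum>i<K n. c n i * d l (v n i))"
        by (rule sum.swap)
      also have "\<dots> = (\<Sum>l<m. T n (j l, j (Suc (Suc l))) - T n (j l, j (Suc l)))"
        by (simp add: T_def E_def d_def N_def right_diff_distrib sum_subtractf)
      finally show ?thesis by (simp add: T_def N_def)
    qed
    have lim: "(\<lambda>n. E (h n) \<Phi>) \<longlonglongrightarrow> L (j m, j (Suc m)) -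
        (\<Sum>l<m. L (j l, j (Suc (Suc l))) - L (j l, j (Suc l)))"
      unfolding E_\<Phi> by (intro tendsto_intros L)
    have "(\<Sum>l<m. L (j l, j (Suc (Suc l))) - L (j l, j (Suc l))) \<le> (\<Sum>l<m. \<eta> l)"
      using J(3) by (intro sum_mono) (simp add: j_Suc diff_le_eq add.commute)
    also have "\<dots> \<le> e / 2" unfolding \<eta>_def sum_halves using e(1) by simp
    finally have "e / 2 < L (j m, j (Suc m)) -
        (\<Sum>l<m. L (j l, j (Suc (Suc l))) - L (j l, j (Suc l)))"
      using J(2)[of "j m" m] by (simp add: j_Suc)
    then have "\<forall>\<^sub>F n in sequentially. e / 2 < E (h n) \<Phi>" by (rule order_tendstoD[OF lim])
    then obtain n where "e / 2 < E (h n) \<Phi>" using eventually_happens by force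
    then obtain i where i: "i < K (h n)" "e / 2 < \<Phi> (v (h n) i)"
      using convex_average_gt[of "K (h n)" "c (h n)" "e / 2" "\<lambda>i. \<Phi> (v (h n) i)"] c
      unfolding E_def by blast
    define a where "a = v (h n) i"
    have "N m a \<le> N l a + (\<Sum>l<m. d l a)" if "l \<le> m" for l
    proof -
      have "N m a - N l a = (\<Sum>i=l..<m. N (Suc i) a - N i a)"
        using sum_Suc_diff'[OF that, of "\<lambda>i. N i a"] by simp
      also have "\<dots> \<le> (\<Sum>i=l..<m. d i a)" using N_d by (intro sum_mono) (simp add: diff_le_eq add.commute)
      also have "\<dots> \<le> (\<Sum>i<m. d i a)" using d0 by (intro sum_mono2) auto
      finally show ?thesis by simp
    qed
    then have "\<forall>l\<le>m. N l a > e / 2" using i(2) unfolding \<Phi>_def a_def[symmetric] by force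
    moreover have "a \<in> A" using v i(1) by (simp add: a_def)
    ultimately show ?thesis by blast
  qed
  then obtain w where w: "\<And>m. w m \<in> A" "\<And>m l. l \<le> m \<Longrightarrow> N l (w m) > e / 2" by metis
  \<comment> \<open>The elements \<open>w m\<close> are large on ever more windows. Their pointwise
    limit is in the space by Banach-Saks and so is small on a late window, where pointwise
    convergence makes the \<open>w (h' n)\<close> small as well.\<close>
  obtain h' a where h': "strict_mono (h' :: nat \<Rightarrow> nat)" "\<And>m. (\<lambda>n. w (h' n) m) \<longlonglongrightarrow> a m"
    using bounded_convergent_subsequence[of w C] C w(1) by metis
  have "a \<in> XF F"
    by (rule banach_saks_subsequence[OF A, of "\<lambda>n. w (h' n)" a]) (use w h'(2) in auto)
  then have "tail_null F a" by (simp add: XF_iff)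
  then obtain k where k: "\<And>s. s \<in> augment F \<Longrightarrow> s \<subseteq> {k..} \<Longrightarrow> asum a s \<le> e / 4"
    by (rule tail_nullE[of F a "e / 4"]) (use e(1) in auto)
  have jk: "k \<le> j k" using seq_suble[OF j_mono] .
  have "\<forall>\<^sub>F n in sequentially. \<forall>s\<in>{s \<in> augment F. s \<subseteq> {j k..<j (Suc k)}}. asum (w (h' n)) s < e / 2"
  proof (rule eventually_ball_finite[OF finite_window], rule ballI)
    fix s assume s: "s \<in> {s \<in> augment F. s \<subseteq> {j k..<j (Suc k)}}"
    then have "s \<subseteq> {k..}" using jk by force
    then have "asum a s < e / 2" using k[of s] s e(1) by force
    then show "\<forall>\<^sub>F n in sequentially. asum (w (h' n)) s < e / 2"
      by (rule order_tendstoD[OF asum_tendsto[OF h'(2)]])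
  qed
  then have "\<forall>\<^sub>F n in sequentially. N k (w (h' n)) \<le> e / 2"
    unfolding N_def window_norm_le_iff by eventually_elim (blast intro: less_imp_le)
  then obtain n where "n \<ge> k" "N k (w (h' n)) \<le> e / 2"
    using eventually_happens[OF eventually_conj[OF _ eventually_ge_at_top[of k]]] by force
  moreover have "k \<le> h' n" using seq_suble[OF h'(1), of n] \<open>n \<ge> k\<close> by simp
  ultimately show False using w(2)[of k "h' n"] by simp
qed

end

section \<open>Sequences with bounded partial sums\<close>

context schreier_like
begin

text \<open>Beyond some \<open>k\<close> the uniform tail estimate applies; the finitely many
  coordinates before it tend to 0.\<close>

lemma lower_norm_eventually_small:
  assumes z: "\<And>m. (\<lambda>n. z n m) \<longlonglongrightarrow> 0"
    and tails: "\<And>p e. e > 0 \<Longrightarrow> \<exists>k. \<forall>n. \<forall>s\<in>L p. s \<subseteq> {k..} \<longrightarrow> asum (z n) s \<le> e"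
    and e: "e > 0"
  shows "\<forall>\<^sub>F n in sequentially. \<forall>s\<in>L p. asum (z n) s \<le> e"
proof -
  obtain k where k: "\<And>n s. s \<in> L p \<Longrightarrow> s \<subseteq> {k..} \<Longrightarrow> asum (z n) s \<le> e / 2"
    using tails[of "e / 2" p] e by auto
  have "(\<lambda>n. asum (z n) {..<k}) \<longlonglongrightarrow> asum (\<lambda>_. 0) {..<k}" by (rule asum_tendsto[OF z])
  then have "\<forall>\<^sub>F n in sequentially. asum (z n) {..<k} < e / 2"
    using e by (intro order_tendstoD) auto
  then show ?thesis
  proof eventually_elim
    case (elim n)
    show ?case
    proof
      fix s assume s: "s \<in> L p"
      then have fin: "finite s" using lower_finite by blast
      have "asum (z n) s = asum (z n) (s \<inter> {..<k}) + asum (z n) (s \<inter> {k..})"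
        using fin by (subst sum.union_disjoint[symmetric]) (auto intro!: sum.cong)
      moreover have "asum (z n) (s \<inter> {..<k}) \<le> asum (z n) {..<k}" by (rule asum_mono) auto
      moreover have "asum (z n) (s \<inter> {k..}) \<le> e / 2"
      proof (cases "s \<inter> {k..} = {}")
        case False
        then show ?thesis using k[OF lower_hereditary[OF s, of "s \<inter> {k..}"]] by simp
      qed (use e in simp)
      ultimately show "asum (z n) s \<le> e" using elim by linarith
    qed
  qed
qed

text \<open>
  Along the chosen subsequence, a set with minimum \<open>q\<close> can carry substantial mass only for the
  one index \<open>l\<close> with \<open>k l < q < k (Suc l)\<close>.
\<close>

lemma bounded_partial_sums:
  assumes z: "\<And>m. (\<lambda>n. z n m) \<longlonglongrightarrow> 0" and C: "\<And>n. norm_bound F (z n) C"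
    and tail: "\<And>n. tail_null F (z n)"
    and tails: "\<And>p e. e > 0 \<Longrightarrow> \<exists>k. \<forall>n. \<forall>s\<in>L p. s \<subseteq> {k..} \<longrightarrow> asum (z n) s \<le> e"
  obtains g where "strict_mono (g :: nat \<Rightarrow> nat)"
    "\<And>n. norm_bound F (\<lambda>m. \<Sum>l<n. z (g l) m) (C + 4)"
proof -
  obtain D where D: "\<And>q s. s \<in> F \<Longrightarrow> s \<noteq> {} \<Longrightarrow> Min s \<le> q \<Longrightarrow>
      \<exists>T. finite T \<and> card T \<le> D q \<and> T \<subseteq> (\<Union>p\<le>D q. L p) \<and> s \<inter> {q<..} \<subseteq> \<Union>T"
    using lower_cover by metis
  \<comment> \<open>Every index outside \<open>bad\<close> costs at most
    \<open>2 * \<epsilon> l\<close>, in total at most 4, and a bad one at most \<open>C\<close>: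
    hence \<open>C + 4\<close>. Dividing by \<open>Suc (D k)\<close> below lets a cover by
    \<open>D k\<close> sets cost no more than \<open>\<epsilon> l\<close>.\<close>
  define \<epsilon> where "\<epsilon> l = (1 / 2 ^ l :: real)" for l :: nat
  have \<epsilon>0: "\<epsilon> l > 0" for l by (simp add: \<epsilon>_def)
  obtain g k where gk: "strict_mono g" "strict_mono k" "k 0 = 0"
    and Q: "\<And>l. asum (z (g l)) {..k l} \<le> \<epsilon> l \<and>
      (\<forall>p\<le>D (k l). \<forall>s\<in>L p. asum (z (g l)) s \<le> \<epsilon> l / real (Suc (D (k l))))"
    and R: "\<And>l. \<forall>s\<in>augment F. s \<subseteq> {k (Suc l)..} \<longrightarrow> asum (z (g l)) s \<le> \<epsilon> l"
  proof (rule gliding_hump[where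
        Q = "\<lambda>l k n. asum (z n) {..k} \<le> \<epsilon> l \<and>
          (\<forall>p\<le>D k. \<forall>s\<in>L p. asum (z n) s \<le> \<epsilon> l / real (Suc (D k)))" and
        R = "\<lambda>l n k. \<forall>s\<in>augment F. s \<subseteq> {k..} \<longrightarrow> asum (z n) s \<le> \<epsilon> l" and ?k0.0 = 0])
    fix l k :: nat
    have "(\<lambda>n. asum (z n) {..k}) \<longlonglongrightarrow> asum (\<lambda>_. 0) {..k}" by (rule asum_tendsto[OF z])
    then have 1: "\<forall>\<^sub>F n in sequentially. asum (z n) {..k} < \<epsilon> l" using \<epsilon>0 by (intro order_tendstoD) auto
    have "\<forall>p\<in>{..D k}. \<forall>\<^sub>F n in sequentially. \<forall>s\<in>L p. asum (z n) s \<le> \<epsilon> l / real (Suc (D k))"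
      using \<epsilon>0 by (intro ballI lower_norm_eventually_small z tails) auto
    then have "\<forall>\<^sub>F n in sequentially. \<forall>p\<in>{..D k}. \<forall>s\<in>L p. asum (z n) s \<le> \<epsilon> l / real (Suc (D k))"
      by (intro eventually_ball_finite) auto
    with 1 show "\<forall>\<^sub>F n in sequentially. asum (z n) {..k} \<le> \<epsilon> l \<and>
        (\<forall>p\<le>D k. \<forall>s\<in>L p. asum (z n) s \<le> \<epsilon> l / real (Suc (D k)))"
      by eventually_elim simp
  next
    fix l n :: nat
    obtain k0 where "\<And>s. s \<in> augment F \<Longrightarrow> s \<subseteq> {k0..} \<Longrightarrow> asum (z n) s \<le> \<epsilon> l"
      by (rule tail_nullE[OF tail \<epsilon>0]) (rule that)
    then have "\<forall>k\<ge>k0. \<forall>s\<in>augment F. s \<subseteq> {k..} \<longrightarrow> asum (z n) s \<le> \<epsilon> l"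
      by (meson atLeast_subset_iff subset_trans)
    then show "\<forall>\<^sub>F k in sequentially. \<forall>s\<in>augment F. s \<subseteq> {k..} \<longrightarrow> asum (z n) s \<le> \<epsilon> l"
      unfolding eventually_sequentially by blast
  qed blast
  have "norm_bound F (\<lambda>m. \<Sum>l<n. z (g l) m) (C + 4)" for n
    unfolding norm_bound_def
  proof
    fix s assume s: "s \<in> augment F"
    show "asum (\<lambda>m. \<Sum>l<n. z (g l) m) s \<le> C + 4"
    proof (cases "s = {}")
      case True then show ?thesis using norm_bound_nonneg[OF C] by simp
    next
      case False
      have fin: "finite s" using augment_finite[OF s] .
      define q where "q = Min s"
      have q: "q \<in> s" "s \<subseteq> {q..}" using fin False by (auto simp: q_def)
      \<comment> \<open>If \<open>q\<close> is at or beyond \<open>k (Suc l)\<close>, the whole set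
        lies in the negligible tail of \<open>z (g l)\<close>. If \<open>q \<le> k l\<close>, the
        cover handles what lies beyond \<open>k l\<close> and \<open>Q\<close> the coordinates up to
        \<open>k l\<close>.\<close>
      define bad where "bad l \<longleftrightarrow> k l < q \<and> q < k (Suc l)" for l
      have good: "asum (z (g l)) s \<le> 2 * \<epsilon> l" if "\<not> bad l" for l
      proof (cases "k (Suc l) \<le> q")
        case True
        then have "s \<subseteq> {k (Suc l)..}" using q(2) by force
        then have "asum (z (g l)) s \<le> \<epsilon> l" using R s by blast
        then show ?thesis using \<epsilon>0[of l] by linarith
      next
        case False
        then have ql: "q \<le> k l" using that by (auto simp: bad_def)
        have "\<exists>T. finite T \<and> card T \<le> D (k l) \<and> T \<subseteq> (\<Union>p\<le>D (k l). L p) \<and> s \<inter> {k l<..} \<subseteq> \<Union>T"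
        proof (cases "s \<in> F")
          case True
          then show ?thesis using D \<open>s \<noteq> {}\<close> ql by (simp add: q_def)
        next
          case False
          \<comment> \<open>A singleton outside \<open>F\<close> has nothing beyond
            \<open>k l\<close>, so the empty cover serves.\<close>
          then have "s = {q}" using s q(1) by (auto simp: augment_def)
          then show ?thesis using ql by (intro exI[of _ "{}"]) auto
        qed
        then obtain T where T: "finite T" "card T \<le> D (k l)" "T \<subseteq> (\<Union>p\<le>D (k l). L p)"
            "s \<inter> {k l<..} \<subseteq> \<Union>T" by blast
        have Tfin: "finite t" if "t \<in> T" for t using T(3) that lower_finite by blast
        have "asum (z (g l)) (s \<inter> {k l<..}) \<le> asum (z (g l)) (\<Union>T)"
          using T(1,4) Tfin by (intro asum_mono) auto
        also have "\<dots> \<le> (\<Sum>t\<in>T. asum (z (g l)) t)"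
          using T(1) Tfin by (intro asum_Union_le) auto
        also have "\<dots> \<le> (\<Sum>t\<in>T. \<epsilon> l / real (Suc (D (k l))))"
          using Q[of l] T(3) by (intro sum_mono) blast
        also have "\<dots> = real (card T) * (\<epsilon> l / real (Suc (D (k l))))" by simp
        also have "\<dots> \<le> real (Suc (D (k l))) * (\<epsilon> l / real (Suc (D (k l))))"
          using T(2) \<epsilon>0[of l] by (intro mult_right_mono) auto
        also have "\<dots> = \<epsilon> l" by simp
        finally have "asum (z (g l)) (s \<inter> {k l<..}) \<le> \<epsilon> l" .
        moreover have "asum (z (g l)) (s \<inter> {..k l}) \<le> asum (z (g l)) {..k l}" by (rule asum_mono) auto
        moreover have "asum (z (g l)) s = asum (z (g l)) (s \<inter> {..k l}) + asum (z (g l)) (s \<inter> {k l<..})"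
          using fin by (subst sum.union_disjoint[symmetric]) (auto intro!: sum.cong)
        ultimately show ?thesis using Q[of l] by linarith
      qed
      have C0: "0 \<le> C" using norm_bound_nonneg[OF C] .
      have bound: "asum (z (g l)) s \<le> 2 * \<epsilon> l + (if bad l then C else 0)" for l
        using good[of l] norm_boundD[OF C s, of "g l"] \<epsilon>0[of l] by (auto intro: add_increasing)
      have uniq: "l = l'" if "bad l" "bad l'" for l l'
      proof (rule ccontr)
        assume "l \<noteq> l'"
        then have "k (Suc l) \<le> k l' \<or> k (Suc l') \<le> k l"
          using gk(2) by (auto simp: strict_mono_less_eq Suc_le_eq)
        then show False using that by (auto simp: bad_def)
      qed
      have bad_sum: "(\<Sum>l<n. if bad l then C else 0) \<le> C"
      proof (cases "\<exists>l. bad l")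
        case True
        then obtain l0 where "\<And>l. bad l \<longleftrightarrow> l = l0" using uniq by blast
        then show ?thesis using C0 by simp
      qed (use C0 in simp)
      have "asum (\<lambda>m. \<Sum>l<n. 1 * z (g l) m) s \<le> (\<Sum>l<n. \<bar>1\<bar> * asum (z (g l)) s)"
        by (rule asum_sum_le)
      also have "\<dots> \<le> (\<Sum>l<n. 2 * \<epsilon> l + (if bad l then C else 0))"
        using bound by (intro sum_mono) simp
      also have "\<dots> = (\<Sum>l<n. 4 / 2 ^ (l + 1)) + (\<Sum>l<n. if bad l then C else 0)"
        by (simp add: sum.distrib \<epsilon>_def)
      also have "\<dots> \<le> 4 + C" using bad_sum by (intro add_mono) (simp_all only: sum_halves, simp)
      finally show ?thesis by simp
    qed
  qed
  with gk(1) show ?thesis by (rule that)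
qed

text \<open>For the nontrivial direction, subtract a pointwise limit and select a subsequence with
  bounded partial sums; its Cesaro means then tend to 0 in norm at rate
  \<open>1 / n\<close>.\<close>

theorem banach_saks_conv_set_iff:
  assumes A: "A \<subseteq> XF F"
  shows "banach_saks_set F A \<longleftrightarrow> banach_saks_set F (conv_set A)"
proof
  assume conv: "banach_saks_set F (conv_set A)"
  have "a \<in> conv_set A" if "a \<in> A" for a
    unfolding conv_set_def
    by (rule CollectI, rule exI[of _ 1], rule exI[of _ "\<lambda>_. 1"], rule exI[of _ "\<lambda>_. a"]) (use that in simp)
  then show "banach_saks_set F A" using conv unfolding banach_saks_set_def by blast
next
  assume BS: "banach_saks_set F A"
  obtain C where C: "\<And>a. a \<in> A \<Longrightarrow> norm_bound F a C" using banach_saks_bounded[OF A BS] by blast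
  have convX: "conv_set A \<subseteq> XF F" by (rule conv_set_subset_XF[OF A])
  show "banach_saks_set F (conv_set A)"
    unfolding banach_saks_set_iff[OF convX]
  proof (intro allI impI)
    fix y :: "nat \<Rightarrow> nat \<Rightarrow> real" assume y: "\<forall>n. y n \<in> conv_set A"
    then have yC: "norm_bound F (y n) C" for n using conv_set_bounded[OF C] by blast
    obtain h b where h: "strict_mono (h :: nat \<Rightarrow> nat)" "\<And>m. (\<lambda>n. y (h n) m) \<longlonglongrightarrow> b m"
      and bC: "norm_bound F b C"
      using bounded_convergent_subsequence[of y C] yC by metis
    have bX: "b \<in> XF F" by (rule conv_set_pointwise_limit_XF[OF A BS _ h(2)]) (use y in blast)
    define z where "z n m = y (h n) m - b m" for n m
    obtain g where g: "strict_mono (g :: nat \<Rightarrow> nat)"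
      and sums: "\<And>n. norm_bound F (\<lambda>m. \<Sum>l<n. z (g l) m) (C + C + 4)"
    proof (rule bounded_partial_sums[of z "C + C"])
      show "(\<lambda>n. z n m) \<longlonglongrightarrow> 0" for m using LIM_zero[OF h(2)[of m]] by (simp add: z_def)
      show "norm_bound F (z n) (C + C)" for n
        unfolding z_def by (rule norm_bound_diff[OF yC bC])
      show "tail_null F (z n)" for n
        unfolding z_def using subsetD[OF convX, of "y (h n)"] y bX
        by (intro tail_null_diff) (auto simp: XF_iff)
      show "\<exists>k. \<forall>n. \<forall>s\<in>L p. s \<subseteq> {k..} \<longrightarrow> asum (z n) s \<le> e" if e: "e > 0" for p and e :: real
      proof -
        obtain k1 where k1: "\<And>a s. a \<in> A \<Longrightarrow> s \<in> L p \<Longrightarrow> s \<subseteq> {k1..} \<Longrightarrow> asum a s \<le> e / 2"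
          using lower_tails[OF A BS, of "e / 2" p] e by fastforce
        obtain k2 where k2: "\<And>s. s \<in> augment F \<Longrightarrow> s \<subseteq> {k2..} \<Longrightarrow> asum b s \<le> e / 2"
        proof (rule tail_nullE)
          show "tail_null F b" "e / 2 > 0" using bX e by (auto simp: XF_iff)
        qed (rule that)
        obtain k3 where k3: "\<And>s. s \<in> L p \<Longrightarrow> s \<subseteq> {k3..} \<Longrightarrow> s \<in> augment F"
          using lower_subset[of p] by blast
        have "asum (z n) s \<le> e" if s: "s \<in> L p" "s \<subseteq> {max k1 (max k2 k3)..}" for n s
        proof -
          have sub: "s \<subseteq> {k1..}" "s \<subseteq> {k2..}" "s \<subseteq> {k3..}" using s(2) by auto
          have "asum (z n) s \<le> asum (y (h n)) s + asum b s" unfolding z_def by (rule asum_diff_le)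
          moreover have "asum (y (h n)) s \<le> e / 2"
            using conv_set_asum_le[of A s "e / 2"] k1[OF _ s(1) sub(1)] y by blast
          moreover have "asum b s \<le> e / 2" using k2[OF k3[OF s(1) sub(3)] sub(2)] .
          ultimately show ?thesis by linarith
        qed
        then show ?thesis by blast
      qed
    qed (rule that)
    have "cesaro_converges F (\<lambda>i. y (h (g i))) b"
      unfolding cesaro_converges_def
    proof (intro allI impI)
      fix e :: real assume e: "e > 0"
      obtain N :: nat where N: "(C + C + 4) / e \<le> real N" using real_arch_simple by blast
      have "norm_bound F (\<lambda>m. (\<Sum>i<Suc n. y (h (g i)) m) / real (Suc n) - b m) e" if "n \<ge> N" for n
      proof -
        have "(\<lambda>m. (\<Sum>i<Suc n. y (h (g i)) m) / real (Suc n) - b m) =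
            (\<lambda>m. 1 / real (Suc n) * (\<Sum>i<Suc n. z (g i) m))"
          by (auto simp: z_def sum_subtractf diff_divide_distrib simp del: sum.lessThan_Suc)
        moreover have "\<bar>1 / real (Suc n)\<bar> * (C + C + 4) \<le> e"
        proof -
          have "(C + C + 4) / e \<le> real (Suc n)" using N that by simp
          then show ?thesis using e by (simp add: field_simps)
        qed
        ultimately show ?thesis
          using norm_bound_mono[OF norm_bound_cmult[OF sums[of "Suc n"], of "1 / real (Suc n)"]] by simp
      qed
      then show "\<exists>N. \<forall>n\<ge>N. norm_bound F (\<lambda>m. (\<Sum>i<Suc n. y (h (g i)) m) / real (Suc n) - b m) e"
        by blast
    qed
    moreover have "strict_mono (\<lambda>i. h (g i))" using h(1) g by (simp add: strict_mono_def)
    ultimately show "\<exists>g b. strict_mono g \<and> b \<in> XF F \<and> cesaro_converges F (\<lambda>i. y (g i)) b"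
      using bX by blast
  qed
qed

end

section \<open>The generalized Schreier families as instances of
  \<open>schreier_like\<close>\<close>

context fundamental_sequences
begin

lemma hereditary_family_schreier_gen:
  assumes "Well_order r"
  shows "hereditary_family (schreier_gen \<beta> r)"
  using schreier_gen_nonempty schreier_gen_finite schreier_gen_subset assms
  by unfold_locales blast+

lemma schreier_like_schreier_gen:
  assumes r: "Well_order r"
  shows "\<exists>L. schreier_like (schreier_gen \<beta> r) L"
proof -
  interpret hereditary_family "schreier_gen \<beta> r" by (rule hereditary_family_schreier_gen[OF r])
  show ?thesis
  proof (cases rule: ord_cases[of r])
    case 1
    \<comment> \<open>A singleton has nothing beyond its minimum, so trivial lower families suffice;
      \<open>fam_otimes\<close> of them is empty because blocks are nonempty.\<close>
    have "schreier_like (schreier_gen \<beta> r) (\<lambda>_. {{}})"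
    proof unfold_locales
      fix q
      have "s \<inter> {q<..} = {}" if "s \<in> schreier_gen \<beta> r" "s \<noteq> {}" "Min s \<le> q" for s
      proof -
        have "card s = 1"
          using that(1,2) by (simp add: schreier_gen_empty[OF 1] card_gt_0_iff le_antisym Suc_leI)
        then obtain x where "s = {x}" by (rule card_1_singletonE)
        then show ?thesis using that(3) by simp
      qed
      then show "\<exists>D. \<forall>s\<in>schreier_gen \<beta> r. s \<noteq> {} \<longrightarrow> Min s \<le> q \<longrightarrow>
          (\<exists>T. finite T \<and> card T \<le> D \<and> T \<subseteq> (\<Union>p\<le>D. {{}}) \<and> s \<inter> {q<..} \<subseteq> \<Union>T)"
        by (intro exI[of _ 0] ballI impI exI[of _ "{}"]) auto
    qed (auto simp: fam_otimes_def)
    then show ?thesis by blast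
  next
    case (2 m)
    define q where "q = Restr r (Field r - {m})"
    have q: "q <o r" using Restr_ord_is_max_ordLess[OF r 2] by (simp add: q_def)
    then have wq: "Well_order q" by (simp add: ordLess_def)
    have S: "schreier_gen \<beta> r = fam_otimes (schreier_gen \<beta> q) schreier"
      using schreier_gen_max[OF r 2] by (simp add: q_def)
    have "schreier_like (schreier_gen \<beta> r) (\<lambda>_. schreier_gen \<beta> q)"
    proof unfold_locales
      fix n
      show "\<exists>D. \<forall>s\<in>schreier_gen \<beta> r. s \<noteq> {} \<longrightarrow> Min s \<le> n \<longrightarrow>
          (\<exists>T. finite T \<and> card T \<le> D \<and> T \<subseteq> (\<Union>p\<le>D. schreier_gen \<beta> q) \<and> s \<inter> {n<..} \<subseteq> \<Union>T)"
      \<comment> \<open>The blocks themselves are the cover, and admissibility bounds their number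
        by \<open>Min s \<le> n\<close>.\<close>
      proof (intro exI[of _ n] ballI impI)
        fix s assume s: "s \<in> schreier_gen \<beta> r" "Min s \<le> n"
        then obtain ss where ss: "ss \<noteq> []" "\<forall>t\<in>set ss. t \<in> schreier_gen \<beta> q \<and> t \<noteq> {}"
            "sorted_wrt (\<lambda>a b. Max a < Min b) ss" "Min ` set ss \<in> schreier" "s = \<Union>(set ss)"
          unfolding S by (auto simp: fam_otimes_def)
        have fin: "\<And>t. t \<in> set ss \<Longrightarrow> finite t \<and> t \<noteq> {}" using ss(2) schreier_gen_finite[OF wq] by blast
        have "card (set ss) \<le> length ss" by (rule card_length)
        also have "\<dots> = card (Min ` set ss)" using sorted_blocks_Min[OF ss(1) fin ss(3)] by simp
        also have "\<dots> \<le> Min (Min ` set ss)" using ss(1,4) by (auto simp: schreier_def)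
        also have "\<dots> = Min s" using sorted_blocks_Min[OF ss(1) fin ss(3)] ss(5) by simp
        finally have "card (set ss) \<le> n" using s(2) by simp
        then show "\<exists>T. finite T \<and> card T \<le> n \<and> T \<subseteq> (\<Union>p\<le>n. schreier_gen \<beta> q) \<and> s \<inter> {n<..} \<subseteq> \<Union>T"
          using ss(2,5) by (intro exI[of _ "set ss"]) auto
      qed
    qed (use schreier_gen_finite[OF wq] schreier_gen_subset[OF wq] S in blast)+
    then show ?thesis by blast
  next
    case 3
    have w: "\<beta> r n <o r" "Well_order (\<beta> r n)" for n
      using fund_wo[OF r 3, of n] by (auto simp: ordLess_def)
    have "schreier_like (schreier_gen \<beta> r) (\<lambda>n. schreier_gen \<beta> (\<beta> r n))"
    proof unfold_locales
      fix p
      show "\<exists>m. \<forall>s\<in>fam_otimes (schreier_gen \<beta> (\<beta> r p)) schreier. s \<subseteq> {m..} \<longrightarrow> s \<in> schreier_gen \<beta> r"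
        by (rule schreier_gen_ordLess[OF r w(1)])
    next
      fix q
      show "\<exists>D. \<forall>s\<in>schreier_gen \<beta> r. s \<noteq> {} \<longrightarrow> Min s \<le> q \<longrightarrow>
          (\<exists>T. finite T \<and> card T \<le> D \<and> T \<subseteq> (\<Union>p\<le>D. schreier_gen \<beta> (\<beta> r p)) \<and> s \<inter> {q<..} \<subseteq> \<Union>T)"
      \<comment> \<open>A set taken from term \<open>n\<close> lies in \<open>{n+1..}\<close>, so
        \<open>n \<le> q\<close> and \<open>s\<close> is its own cover. \<open>Suc q\<close> bounds
        both this index and the size 1 of the cover.\<close>
      proof (intro exI[of _ "Suc q"] ballI impI)
        fix s assume s: "s \<in> schreier_gen \<beta> r" "s \<noteq> {}" "Min s \<le> q"
        then obtain n where n: "s \<in> schreier_gen \<beta> (\<beta> r n)" "s \<subseteq> {n+1..}"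
          unfolding schreier_gen_limit[OF 3] by blast
        have "Min s \<in> s" using s(1,2) finite_sets by (intro Min_in) auto
        then have "n \<le> q" using n(2) s(3) by force
        then show "\<exists>T. finite T \<and> card T \<le> Suc q \<and> T \<subseteq> (\<Union>p\<le>Suc q. schreier_gen \<beta> (\<beta> r p)) \<and>
            s \<inter> {q<..} \<subseteq> \<Union>T"
          using n(1) by (intro exI[of _ "{s}"]) (auto intro!: bexI[of _ n])
      qed
    qed (use schreier_gen_finite[OF w(2)] schreier_gen_subset[OF w(2)] in blast)+
    then show ?thesis by blast
  qed
qed

end

theorem theorem3p5:
  fixes \<beta> :: "nat rel \<Rightarrow> nat \<Rightarrow> nat rel" and r :: "nat rel" and A :: "(nat \<Rightarrow> real) set"
  assumes fund_wo: "\<And>q n. Well_order q \<Longrightarrow> ord_is_limit q \<Longrightarrow> (\<beta> q n, q) \<in> ordLess"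
    and fund_incr: "\<And>q n. Well_order q \<Longrightarrow> ord_is_limit q \<Longrightarrow> 1 \<le> n \<Longrightarrow>
                      (\<beta> q n, \<beta> q (Suc n)) \<in> ordLess"
    and fund_sup: "\<And>q (p :: nat rel). Well_order q \<Longrightarrow> ord_is_limit q \<Longrightarrow> (p, q) \<in> ordLess \<Longrightarrow>
                      \<exists>n\<ge>1. (p, \<beta> q n) \<in> ordLeq"
    and fund_inv: "\<And>q q' n. ord_is_limit q \<Longrightarrow> (q, q') \<in> ordIso \<Longrightarrow>
                      (\<beta> q n, \<beta> q' n) \<in> ordIso"
    and wo: "Well_order r"
    and A: "A \<subseteq> XF (schreier_gen \<beta> r)"
  shows "banach_saks_set (schreier_gen \<beta> r) A \<longleftrightarrow>
         banach_saks_set (schreier_gen \<beta> r) (conv_set A)"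
proof -
  interpret fundamental_sequences \<beta>
    by (rule fundamental_sequences.intro[OF fund_wo fund_incr fund_sup fund_inv])
  obtain L where "schreier_like (schreier_gen \<beta> r) L"
    using schreier_like_schreier_gen[OF wo] ..
  then show ?thesis by (rule schreier_like.banach_saks_conv_set_iff[OF _ A])
qed

end
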